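(* Let $n$ be a positive integer. The set $A_n=\{G_\alpha:\alpha\in\{0,1\}^n\text{ breaks the ballot condition}\}$ is a (non-reduced, non-minimal) Gröbner basis of $I_n$. A minimal Gröbner basis for $I_n$ is given by $$\big\{G_\alpha:\alpha\in\{0,1\}^n\text{ breaks the ballot condition only at the rightmost }1\text{ of }\alpha\big\}.$$
   Context: Let $R_n=\mathbb{Q}[\theta_1,\dots,\theta_n]$ be the polynomial ring in anticommuting variables over $\mathbb{Q}$ (exterior algebra): $\theta_i\theta_j=-\theta_j\theta_i$ for $i\ne j$, $\theta_i^2=0$. For $A=\{a_1<\cdots<a_r\}\subseteq[n]=\{1,\dots,n\}$ put $\theta_A=\theta_{a_1}\cdots\theta_{a_r}$, and $F_{1^r}=\sum_{A\subseteq[n],|A|=r}\theta_A$ (so $F_{1^0}=1$). Let $I_n$ be the ideal of $R_n$ generated by $F_{1^r}$, $1\le r\le n$. A sequence $\alpha=(a_1,\dots,a_n)\in\{0,1\}^n$ breaks the ballot condition at position $r$ if $\sum_{i=1}^r a_i>r/2$; it breaks the ballot condition if it does so at some position $1\le r\le n$, and otherwise it is a ballot sequence. It breaks the ballot condition only at its rightmost $1$ if the position of the rightmost $1$ of $\alpha$ is the only position at which it breaks the ballot condition. For a $0$-$1$ string $u$ let $m_1(u)$ be its number of $1$s. For $\alpha\in\{0,1\}^n$ (written as a string) the element $G_\alpha\in R_n$ is defined recursively: $G_{1^s0^{n-s}}=F_{1^s}$ for $0\le s\le n$; otherwise $\alpha$ is uniquely of the form $u01^s0^{n-k-s}$ with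 $s\ge 1$ and $u$ a string of length $k-1$, and $$G_{u01^s0^{n-k-s}}=G_{u1^s0^{n-k-s+1}}-(-1)^{m_1(u)}\theta_k\,G_{u1^{s-1}0^{n-k-s+2}}.$$ Gröbner bases are taken with respect to the lexicographic order: monomials $\theta^\alpha=\theta_1^{a_1}\cdots\theta_n^{a_n}$, $\alpha\in\{0,1\}^n$, are ordered by $\theta^\alpha<\theta^\beta$ iff there is $j$ with $a_i=b_i$ for $i<j$ and $a_j<b_j$ (so $\theta_1>\cdots>\theta_n$). The leading monomial of a nonzero polynomial is its lexicographically largest monomial. A Gröbner basis of $I_n$ is a finite set $\mathcal{G}\subseteq I_n$ of nonzero elements such that the leading monomial of each nonzero $f\in I_n$ is divisible by the leading monomial of some $g\in\mathcal{G}$ ($\theta_B$ divides $\theta_A$ iff $B\subseteq A$). It is minimal if all leading coefficients are $1$ and no leading monomial of an element of $\mathcal{G}$ divides the leading monomial of a different element of $\mathcal{G}$; it is reduced if all leading coefficients are $1$ and no monomial occurring in an element of $\mathcal{G}$ is divisible by the leading monomial of a different element of $\mathcal{G}$.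
   Formalization: The parenthetical claim that A_n is non-reduced and non-minimal is stated only for n ≥ 2, since for n = 1 the set A_1 = {θ_1} is both reduced and minimal; the two Gröbner basis claims are for all positive n. *)

theory Defs
  imports Complex_Main "HOL-Algebra.Ideal" "HOL-Library.Poly_Mapping"
begin

section \<open>The polynomial ring in anticommuting variables\<close>

text \<open>
  An element is the finitely supported family of its coefficients: the key \<open>A\<close> stands for the
  monomial \<open>\<theta>\<^sub>A\<close>, the product of the \<open>\<theta>\<^sub>a\<close> for \<open>a \<in> A\<close> in increasing order, and
  \<open>Poly_Mapping.single A c\<close> is \<open>c \<theta>\<^sub>A\<close>.
\<close>

type_synonym ext = "nat set \<Rightarrow>\<^sub>0 rat"

text \<open>
  Sorting the concatenation of \<open>A\<close> and \<open>B\<close> takes one transposition of adjacent variables for every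
  pair \<open>a \<in> A\<close>, \<open>b \<in> B\<close> with \<open>b < a\<close>; this gives the sign in \<open>\<theta>\<^sub>A \<theta>\<^sub>B = \<plusminus>\<theta>\<^sub>A\<^sub>\<union>\<^sub>B\<close> for disjoint
  \<open>A\<close> and \<open>B\<close>.
\<close>

definition sort_sign :: "nat set \<Rightarrow> nat set \<Rightarrow> rat" where
  "sort_sign A B = (- 1) ^ card {(a, b). a \<in> A \<and> b \<in> B \<and> b < a}"

definition mono_mult :: "nat set \<Rightarrow> nat set \<Rightarrow> rat \<Rightarrow> ext" where
  "mono_mult A B c =
    (if A \<inter> B = {} then Poly_Mapping.single (A \<union> B) (sort_sign A B * c) else 0)"

definition wedge :: "ext \<Rightarrow> ext \<Rightarrow> ext" where
  "wedge f g = (\<Sum>A\<in>Poly_Mapping.keys f. \<Sum>B\<in>Poly_Mapping.keys g.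
     mono_mult A B (Poly_Mapping.lookup f A * Poly_Mapping.lookup g B))"

definition ext_ring :: "nat \<Rightarrow> ext ring" where
  "ext_ring n =
    \<lparr>carrier = {f. \<forall>A\<in>Poly_Mapping.keys f. A \<subseteq> {1..n}},
     monoid.mult = wedge, one = Poly_Mapping.single {} 1, zero = 0, add = (+)\<rparr>"

lemma mono_mult_zero [simp]: "mono_mult A B 0 = 0"
  by (simp add: mono_mult_def)

lemma mono_mult_add: "mono_mult A B (c + d) = mono_mult A B c + mono_mult A B d"
  by (simp add: mono_mult_def single_add distrib_left)

lemma wedge_superset:
  assumes "finite S" "finite T" "Poly_Mapping.keys f \<subseteq> S" "Poly_Mapping.keys g \<subseteq> T"
  shows "wedge f g = (\<Sum>A\<in>S. \<Sum>B\<in>T.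
     mono_mult A B (Poly_Mapping.lookup f A * Poly_Mapping.lookup g B))"
proof -
  have "wedge f g = (\<Sum>A\<in>Poly_Mapping.keys f. \<Sum>B\<in>T.
     mono_mult A B (Poly_Mapping.lookup f A * Poly_Mapping.lookup g B))"
    unfolding wedge_def using assms
    by (intro sum.cong refl sum.mono_neutral_left) (auto simp: in_keys_iff)
  also have "\<dots> = (\<Sum>A\<in>S. \<Sum>B\<in>T.
     mono_mult A B (Poly_Mapping.lookup f A * Poly_Mapping.lookup g B))"
    using assms by (intro sum.mono_neutral_left) (auto simp: in_keys_iff)
  finally show ?thesis .
qed

lemma wedge_add_left: "wedge (f + g) h = wedge f h + wedge g h"
proof -
  let ?S = "Poly_Mapping.keys f \<union> Poly_Mapping.keys g" and ?T = "Poly_Mapping.keys h"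
  have "Poly_Mapping.keys (f + g) \<subseteq> ?S" by (rule keys_add)
  then show ?thesis
    by (subst (1 2 3) wedge_superset[of ?S ?T])
      (auto simp: lookup_add distrib_right mono_mult_add sum.distrib)
qed

lemma wedge_add_right: "wedge h (f + g) = wedge h f + wedge h g"
proof -
  let ?S = "Poly_Mapping.keys f \<union> Poly_Mapping.keys g" and ?T = "Poly_Mapping.keys h"
  have "Poly_Mapping.keys (f + g) \<subseteq> ?S" by (rule keys_add)
  then show ?thesis
    by (subst (1 2 3) wedge_superset[of ?T ?S])
      (auto simp: lookup_add distrib_left mono_mult_add sum.distrib)
qed

lemma wedge_zero [simp]: "wedge 0 f = 0" "wedge f 0 = 0"
  by (simp_all add: wedge_def)

lemma wedge_sum_left: "wedge (\<Sum>i\<in>I. f i) g = (\<Sum>i\<in>I. wedge (f i) g)"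
  by (induction I rule: infinite_finite_induct) (auto simp: wedge_add_left)

lemma wedge_sum_right: "wedge g (\<Sum>i\<in>I. f i) = (\<Sum>i\<in>I. wedge g (f i))"
  by (induction I rule: infinite_finite_induct) (auto simp: wedge_add_right)

lemma wedge_single:
  "wedge (Poly_Mapping.single A a) (Poly_Mapping.single B b) = mono_mult A B (a * b)"
  by (subst wedge_superset[of "{A}" "{B}"]) auto

lemma ext_expand: "f = (\<Sum>A\<in>Poly_Mapping.keys f. Poly_Mapping.single A (Poly_Mapping.lookup f A))"
  for f :: ext
  by (rule poly_mapping_eqI)
    (auto simp: lookup_sum lookup_single when_def sum.delta in_keys_iff)

lemma sort_sign_Un_left:
  assumes "finite A" "finite B" "finite C" "A \<inter> B = {}"
  shows "sort_sign (A \<union> B) C = sort_sign A C * sort_sign B C"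
proof -
  let ?P = "\<lambda>A. {(a, b). a \<in> A \<and> b \<in> C \<and> b < a}"
  have fin: "finite (?P A)" "finite (?P B)"
    by (rule finite_subset[of _ "A \<times> C"] finite_subset[of _ "B \<times> C"]; use assms in auto)+
  have "?P (A \<union> B) = ?P A \<union> ?P B" by auto
  moreover have "?P A \<inter> ?P B = {}" using assms by auto
  ultimately have "card (?P (A \<union> B)) = card (?P A) + card (?P B)"
    using fin by (simp add: card_Un_disjoint)
  then show ?thesis by (simp only: sort_sign_def power_add)
qed

lemma sort_sign_Un_right:
  assumes "finite A" "finite B" "finite C" "A \<inter> B = {}"
  shows "sort_sign C (A \<union> B) = sort_sign C A * sort_sign C B"
proof -
  let ?P = "\<lambda>A. {(a, b). a \<in> C \<and> b \<in> A \<and> b < a}"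
  have fin: "finite (?P A)" "finite (?P B)"
    by (rule finite_subset[of _ "C \<times> A"] finite_subset[of _ "C \<times> B"]; use assms in auto)+
  have "?P (A \<union> B) = ?P A \<union> ?P B" by auto
  moreover have "?P A \<inter> ?P B = {}" using assms by auto
  ultimately have "card (?P (A \<union> B)) = card (?P A) + card (?P B)"
    using fin by (simp add: card_Un_disjoint)
  then show ?thesis by (simp only: sort_sign_def power_add)
qed

lemma wedge_assoc_single:
  assumes "finite A" "finite B" "finite C"
  shows "wedge (wedge (Poly_Mapping.single A a) (Poly_Mapping.single B b)) (Poly_Mapping.single C c)
       = wedge (Poly_Mapping.single A a) (wedge (Poly_Mapping.single B b) (Poly_Mapping.single C c))"
proof (cases "A \<inter> B = {} \<and> A \<inter> C = {} \<and> B \<inter> C = {}")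
  case True
  then have "(A \<union> B) \<inter> C = {}" "A \<inter> (B \<union> C) = {}" by auto
  with True assms show ?thesis
    by (simp add: wedge_single mono_mult_def sort_sign_Un_left sort_sign_Un_right mult_ac Un_assoc)
next
  case False
  then show ?thesis
    by (auto simp: wedge_single mono_mult_def Int_Un_distrib Int_Un_distrib2)
qed

lemma wedge_assoc:
  assumes "\<forall>A\<in>Poly_Mapping.keys f. finite A" "\<forall>A\<in>Poly_Mapping.keys g. finite A"
    "\<forall>A\<in>Poly_Mapping.keys h. finite A"
  shows "wedge (wedge f g) h = wedge f (wedge g h)"
proof -
  let ?K = Poly_Mapping.keys and ?m = "\<lambda>f A. Poly_Mapping.single A (Poly_Mapping.lookup f A)"
  have "wedge (wedge (sum (?m f) (?K f)) (sum (?m g) (?K g))) (sum (?m h) (?K h))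
      = wedge (sum (?m f) (?K f)) (wedge (sum (?m g) (?K g)) (sum (?m h) (?K h)))"
    unfolding wedge_sum_left wedge_sum_right
    using assms by (intro sum.cong refl wedge_assoc_single) auto
  then show ?thesis by (simp only: ext_expand[symmetric])
qed

lemma keys_wedge:
  assumes "C \<in> Poly_Mapping.keys (wedge f g)"
  shows "\<exists>A\<in>Poly_Mapping.keys f. \<exists>B\<in>Poly_Mapping.keys g. C = A \<union> B"
proof -
  have "Poly_Mapping.lookup (wedge f g) C \<noteq> 0" using assms by (simp add: in_keys_iff)
  then obtain A where A: "A \<in> Poly_Mapping.keys f"
    and "(\<Sum>B\<in>Poly_Mapping.keys g. Poly_Mapping.lookup (mono_mult A B
            (Poly_Mapping.lookup f A * Poly_Mapping.lookup g B)) C) \<noteq> 0"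
    unfolding wedge_def lookup_sum by (meson sum.neutral)
  then obtain B where B: "B \<in> Poly_Mapping.keys g"
    and "Poly_Mapping.lookup (mono_mult A B
            (Poly_Mapping.lookup f A * Poly_Mapping.lookup g B)) C \<noteq> 0"
    by (meson sum.neutral)
  then have "C = A \<union> B"
    by (auto simp: mono_mult_def lookup_single when_def split: if_splits)
  with A B show ?thesis by blast
qed

lemma wedge_one:
  "wedge (Poly_Mapping.single {} 1) f = f" "wedge f (Poly_Mapping.single {} 1) = f"
proof -
  show "wedge (Poly_Mapping.single {} 1) f = f"
    by (subst (2) ext_expand, subst wedge_superset[of "{{}}" "Poly_Mapping.keys f"])
      (auto simp: mono_mult_def sort_sign_def)
  show "wedge f (Poly_Mapping.single {} 1) = f"
    by (subst (2) ext_expand, subst wedge_superset[of "Poly_Mapping.keys f" "{{}}"])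
      (auto simp: mono_mult_def sort_sign_def)
qed

lemma ring_ext_ring: "ring (ext_ring n)"
proof (rule ringI)
  let ?R = "ext_ring n"
  have fin: "\<forall>A\<in>Poly_Mapping.keys f. finite A" if "f \<in> carrier ?R" for f
    using that by (auto simp: ext_ring_def intro: finite_subset)
  show "abelian_group ?R"
  proof (rule abelian_groupI)
    fix x y assume "x \<in> carrier ?R" "y \<in> carrier ?R"
    then show "x \<oplus>\<^bsub>?R\<^esub> y \<in> carrier ?R"
      using keys_add[of x y] by (auto simp: ext_ring_def)
  next
    fix x assume "x \<in> carrier ?R"
    then show "\<exists>y\<in>carrier ?R. y \<oplus>\<^bsub>?R\<^esub> x = \<zero>\<^bsub>?R\<^esub>"
      by (intro bexI[of _ "- x"]) (auto simp: ext_ring_def in_keys_iff)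
  qed (auto simp: ext_ring_def add_ac)
  show "monoid ?R"
  proof (rule monoidI)
    fix x y assume "x \<in> carrier ?R" "y \<in> carrier ?R"
    then show "x \<otimes>\<^bsub>?R\<^esub> y \<in> carrier ?R"
      by (fastforce simp: ext_ring_def dest!: keys_wedge)
  next
    fix x y z assume "x \<in> carrier ?R" "y \<in> carrier ?R" "z \<in> carrier ?R"
    then show "x \<otimes>\<^bsub>?R\<^esub> y \<otimes>\<^bsub>?R\<^esub> z = x \<otimes>\<^bsub>?R\<^esub> (y \<otimes>\<^bsub>?R\<^esub> z)"
      using wedge_assoc[OF fin fin fin] by (simp add: ext_ring_def)
  qed (auto simp: ext_ring_def wedge_one)
qed (auto simp: ext_ring_def wedge_add_left wedge_add_right)

lemma theta_anticommute:
  "wedge (Poly_Mapping.single {i} 1) (Poly_Mapping.single {j} 1)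
     = - wedge (Poly_Mapping.single {j} 1) (Poly_Mapping.single {i} 1)"
proof -
  have *: "{(a, b). a = i \<and> b = j \<and> b < a} = (if j < i then {(i, j)} else {})" for i j :: nat
    by auto
  show ?thesis
    by (cases i j rule: linorder_cases)
      (simp_all add: wedge_single mono_mult_def sort_sign_def * single_uminus insert_commute)
qed

lemma theta_square: "wedge (Poly_Mapping.single {i} 1) (Poly_Mapping.single {i} 1) = 0"
  by (simp add: wedge_single mono_mult_def)

lemma theta_ordered_product:
  assumes "\<forall>a\<in>A. i < a"
  shows "wedge (Poly_Mapping.single {i} 1) (Poly_Mapping.single A 1)
     = Poly_Mapping.single (insert i A) 1"
proof -
  have *: "{(a, b). a = i \<and> b \<in> A \<and> b < a} = {}" using assms by auto
  have "i \<notin> A" using assms by auto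
  then show ?thesis by (simp add: wedge_single mono_mult_def sort_sign_def *)
qed

definition F_poly :: "nat \<Rightarrow> nat \<Rightarrow> ext" where
  "F_poly n r = (\<Sum>A\<in>{A. A \<subseteq> {1..n} \<and> card A = r}. Poly_Mapping.single A 1)"

definition I_ideal :: "nat \<Rightarrow> ext set" where
  "I_ideal n = Idl\<^bsub>ext_ring n\<^esub> {F_poly n r | r. 1 \<le> r \<and> r \<le> n}"


section \<open>Ballot sequences\<close>

text \<open>
  A 0-1 string is a list of truth values, \<open>True\<close> being the letter 1. Positions are counted from 1,
  so that position \<open>p\<close> holds the letter \<open>\<alpha> ! (p - 1)\<close>.
\<close>

definition m1 :: "bool list \<Rightarrow> nat" where
  "m1 u = count_list u True"

definition breaks_ballot_at :: "bool list \<Rightarrow> nat \<Rightarrow> bool" where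
  "breaks_ballot_at \<alpha> r \<longleftrightarrow> real (m1 (take r \<alpha>)) > real r / 2"

definition breaks_ballot :: "bool list \<Rightarrow> bool" where
  "breaks_ballot \<alpha> \<longleftrightarrow> (\<exists>r\<in>{1..length \<alpha>}. breaks_ballot_at \<alpha> r)"

definition rightmost_one :: "bool list \<Rightarrow> nat \<Rightarrow> bool" where
  "rightmost_one \<alpha> p \<longleftrightarrow> p \<in> {1..length \<alpha>} \<and> \<alpha> ! (p - 1) \<and>
     (\<forall>q\<in>{1..length \<alpha>}. \<alpha> ! (q - 1) \<longrightarrow> q \<le> p)"

definition breaks_ballot_only_at_rightmost_one :: "bool list \<Rightarrow> bool" where
  "breaks_ballot_only_at_rightmost_one \<alpha> \<longleftrightarrow>
     (\<exists>p. rightmost_one \<alpha> p \<and> (\<forall>r\<in>{1..length \<alpha>}. breaks_ballot_at \<alpha> r \<longleftrightarrow> r = p))"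


section \<open>The elements \<open>G\<^sub>\<alpha>\<close>\<close>

lemma trailing_block: "\<exists>w s. xs = w @ replicate s x \<and> (w = [] \<or> last w \<noteq> x)"
proof (induction xs rule: rev_induct)
  case (snoc y xs)
  show ?case
  proof (cases "y = x")
    case True
    from snoc obtain w s where "xs = w @ replicate s x" "w = [] \<or> last w \<noteq> x" by blast
    with True show ?thesis
      by (intro exI[of _ w] exI[of _ "Suc s"]) (simp add: replicate_append_same)
  next
    case False
    then show ?thesis by (intro exI[of _ "xs @ [y]"] exI[of _ 0]) simp
  qed
qed simp

lemma leading_block_eq:
  assumes "replicate s x @ y # xs = replicate t x @ y # ys" "x \<noteq> y"
  shows "s = t \<and> xs = ys"
  using assms(1)
proof (induction s arbitrary: t)
  case 0
  then show ?case using assms(2) by (cases t) auto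
next
  case (Suc s)
  then show ?case using assms(2) by (cases t) auto
qed

lemma string_cases:
  obtains (base) s t where "\<alpha> = replicate s True @ replicate t False"
  | (step) u s t where "s \<ge> 1" "\<alpha> = u @ [False] @ replicate s True @ replicate t False"
proof -
  obtain v t where v: "\<alpha> = v @ replicate t False" "v = [] \<or> last v \<noteq> False"
    using trailing_block[of \<alpha> False] by blast
  obtain w s where w: "v = w @ replicate s True" "w = [] \<or> last w \<noteq> True"
    using trailing_block[of v True] by blast
  show thesis
  proof (cases "w = []")
    case True
    then show thesis by (intro base[of s t]) (simp add: v(1) w(1))
  next
    case False
    with w have last: "last w = False" by simp
    with False obtain u where u: "w = u @ [False]" by (metis append_butlast_last_id)
    have "s \<ge> 1" using v(2) w(1) last \<open>w \<noteq> []\<close> by (cases s) simp_all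
    moreover have "\<alpha> = u @ [False] @ replicate s True @ replicate t False"
      by (simp only: v(1) w(1) u append_assoc)
    ultimately show thesis by (rule step)
  qed
qed

lemma string_step_unique:
  assumes "u @ [False] @ replicate s True @ replicate t False
         = u' @ [False] @ replicate s' True @ replicate t' False" "s \<ge> 1" "s' \<ge> 1"
  shows "u = u' \<and> s = s' \<and> t = t'"
proof -
  obtain r r' where r: "s = Suc r" "s' = Suc r'"
    using assms(2,3) by (cases s; cases s') auto
  have "rev (u @ [False] @ replicate s True @ replicate t False)
      = rev (u' @ [False] @ replicate s' True @ replicate t' False)"
    using assms(1) by (rule arg_cong)
  then have "replicate t False @ True # (replicate r True @ False # rev u)
      = replicate t' False @ True # (replicate r' True @ False # rev u')"
    by (simp add: r replicate_app_Cons_same)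
  then have 1: "t = t' \<and> replicate r True @ False # rev u = replicate r' True @ False # rev u'"
    by (rule leading_block_eq) simp
  then have "replicate r True @ False # rev u = replicate r' True @ False # rev u'" by (rule conjunct2)
  then have "r = r' \<and> rev u = rev u'"
    by (rule leading_block_eq) simp
  with 1 show ?thesis using r by simp
qed

lemma string_base_not_step:
  assumes "replicate s' True @ replicate t' False
         = u @ [False] @ replicate s True @ replicate t False" "s \<ge> 1"
  shows False
  using assms(1)
proof (induction u arbitrary: s')
  case Nil
  show ?case
  proof (cases s')
    case 0
    with Nil have "True \<in> set (replicate t' False)"
      using assms(2) by (cases s) auto
    then show ?thesis by auto
  next
    case (Suc m)
    then show ?thesis using Nil by auto
  qed
next
  case (Cons x u)
  show ?case
  proof (cases s')
    case 0
    with Cons.prems have "True \<in> set (replicate t' False)"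
      using assms(2) by (cases s) auto
    then show ?thesis by auto
  next
    case (Suc m)
    then show ?thesis using Cons by auto
  qed
qed

text \<open>In the recursive equation, \<open>\<alpha>\<close> has length \<open>n = k + s + t\<close> with \<open>k = length u + 1\<close>.\<close>

function G_poly :: "bool list \<Rightarrow> ext" where
  G_poly_base: "G_poly (replicate s True @ replicate t False) = F_poly (s + t) s"
| G_poly_step: "s \<ge> 1 \<Longrightarrow> G_poly (u @ [False] @ replicate s True @ replicate t False) =
    G_poly (u @ replicate s True @ replicate (t + 1) False)
    - wedge (Poly_Mapping.single {length u + 1} ((- 1) ^ m1 u))
        (G_poly (u @ replicate (s - 1) True @ replicate (t + 2) False))"
proof goal_cases
  case (1 P x)
  then show ?case by (cases x rule: string_cases) blast+
next
  case (2 s t s' t')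
  then have "count_list (replicate s True @ replicate t False) True
      = count_list (replicate s' True @ replicate t' False) True"
    "length (replicate s True @ replicate t False) = length (replicate s' True @ replicate t' False)"
    by simp_all
  moreover have "count_list (replicate s True @ replicate t False) True = s" for s t
    by (induction s; induction t) simp_all
  ultimately show ?case by simp
next
  case (3 s t s' u t')
  then show ?case using string_base_not_step by blast
next
  case (4 s u t s' u' t')
  then show ?case using string_step_unique by blast
qed

primrec pos_sum :: "nat \<Rightarrow> bool list \<Rightarrow> nat" where
  "pos_sum p [] = 0"
| "pos_sum p (x # xs) = (if x then p else 0) + pos_sum (Suc p) xs"

lemma pos_sum_append: "pos_sum p (xs @ ys) = pos_sum p xs + pos_sum (p + length xs) ys"
  by (induction xs arbitrary: p) auto

lemma pos_sum_zeros: "pos_sum p (replicate t False) = 0"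
  by (induction t arbitrary: p) auto

lemma pos_sum_ones: "pos_sum (Suc p) (replicate s True) = pos_sum p (replicate s True) + s"
  by (induction s arbitrary: p) auto

termination
proof (relation "measure (pos_sum 1)", goal_cases)
  case (2 s u t)
  then show ?case by (simp add: pos_sum_append pos_sum_zeros pos_sum_ones)
next
  case (3 s u t)
  then obtain r where "s = Suc r" by (cases s) auto
  then show ?case by (simp add: pos_sum_append pos_sum_zeros pos_sum_ones)
qed simp


section \<open>Groebner bases for the lexicographic order\<close>

definition lex_less :: "nat set \<Rightarrow> nat set \<Rightarrow> bool" where
  "lex_less A B \<longleftrightarrow> (\<exists>j. (\<forall>i<j. i \<in> A \<longleftrightarrow> i \<in> B) \<and> j \<notin> A \<and> j \<in> B)"

definition lead_mono :: "ext \<Rightarrow> nat set" where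
  "lead_mono f = (THE A. A \<in> Poly_Mapping.keys f \<and>
     (\<forall>B\<in>Poly_Mapping.keys f. B \<noteq> A \<longrightarrow> lex_less B A))"

definition lead_coef :: "ext \<Rightarrow> rat" where
  "lead_coef f = Poly_Mapping.lookup f (lead_mono f)"

definition groebner_basis :: "ext set \<Rightarrow> ext set \<Rightarrow> bool" where
  "groebner_basis I \<G> \<longleftrightarrow> finite \<G> \<and> \<G> \<subseteq> I \<and> 0 \<notin> \<G> \<and>
     (\<forall>f\<in>I. f \<noteq> 0 \<longrightarrow> (\<exists>g\<in>\<G>. lead_mono g \<subseteq> lead_mono f))"

definition minimal_groebner_basis :: "ext set \<Rightarrow> ext set \<Rightarrow> bool" where
  "minimal_groebner_basis I \<G> \<longleftrightarrow> groebner_basis I \<G> \<and> (\<forall>g\<in>\<G>. lead_coef g = 1) \<and>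
     (\<forall>g\<in>\<G>. \<forall>h\<in>\<G>. g \<noteq> h \<longrightarrow> \<not> lead_mono g \<subseteq> lead_mono h)"

definition reduced_groebner_basis :: "ext set \<Rightarrow> ext set \<Rightarrow> bool" where
  "reduced_groebner_basis I \<G> \<longleftrightarrow> groebner_basis I \<G> \<and> (\<forall>g\<in>\<G>. lead_coef g = 1) \<and>
     (\<forall>g\<in>\<G>. \<forall>h\<in>\<G>. g \<noteq> h \<longrightarrow> (\<forall>A\<in>Poly_Mapping.keys h. \<not> lead_mono g \<subseteq> A))"

text \<open>The description defining \<open>lead_mono f\<close> is satisfied whenever \<open>f \<noteq> 0\<close>.\<close>

lemma lex_less_total:
  assumes "A \<noteq> B"
  shows "lex_less A B \<or> lex_less B A"
proof -
  define j where "j = (LEAST i. (i \<in> A) \<noteq> (i \<in> B))"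
  have "\<exists>i. (i \<in> A) \<noteq> (i \<in> B)" using assms by blast
  then have "(j \<in> A) \<noteq> (j \<in> B)" unfolding j_def by (rule LeastI_ex)
  moreover have "\<forall>i<j. i \<in> A \<longleftrightarrow> i \<in> B" unfolding j_def using not_less_Least by blast
  ultimately show ?thesis unfolding lex_less_def by blast
qed

lemma lex_less_asym: "lex_less A B \<Longrightarrow> \<not> lex_less B A"
  unfolding lex_less_def by (metis linorder_neqE_nat)

lemma lex_less_trans: "lex_less A B \<Longrightarrow> lex_less B C \<Longrightarrow> lex_less A C"
proof -
  assume "lex_less A B" "lex_less B C"
  then obtain i j where "\<forall>l<i. l \<in> A \<longleftrightarrow> l \<in> B" "i \<notin> A" "i \<in> B"
    "\<forall>l<j. l \<in> B \<longleftrightarrow> l \<in> C" "j \<notin> B" "j \<in> C"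
    unfolding lex_less_def by blast
  then show ?thesis unfolding lex_less_def
    by (intro exI[of _ "min i j"]) (cases i j rule: linorder_cases; auto simp: min_def)
qed

lemma lead_mono_props:
  assumes "f \<noteq> 0"
  shows "lead_mono f \<in> Poly_Mapping.keys f"
    and "\<And>B. B \<in> Poly_Mapping.keys f \<Longrightarrow> B \<noteq> lead_mono f \<Longrightarrow> lex_less B (lead_mono f)"
proof -
  have ex: "S \<noteq> {} \<Longrightarrow> \<exists>A\<in>S. \<forall>B\<in>S. B \<noteq> A \<longrightarrow> lex_less B A" if "finite S" for S
    using that
  proof (induction S rule: finite_induct)
    case (insert C S)
    show ?case
    proof (cases "S = {}")
      case False
      with insert obtain A where "A \<in> S" "\<forall>B\<in>S. B \<noteq> A \<longrightarrow> lex_less B A" by blast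
      then show ?thesis using lex_less_total[of A C] lex_less_trans
        by (metis insert_iff)
    qed simp
  qed simp
  have "Poly_Mapping.keys f \<noteq> {}" using assms
    by (metis ex_in_conv in_keys_iff lookup_zero poly_mapping_eqI)
  with ex[of "Poly_Mapping.keys f"] have "\<exists>!A. A \<in> Poly_Mapping.keys f \<and>
     (\<forall>B\<in>Poly_Mapping.keys f. B \<noteq> A \<longrightarrow> lex_less B A)"
    using lex_less_asym by (metis finite_keys)
  from theI'[OF this] show "lead_mono f \<in> Poly_Mapping.keys f"
    "\<And>B. B \<in> Poly_Mapping.keys f \<Longrightarrow> B \<noteq> lead_mono f \<Longrightarrow> lex_less B (lead_mono f)"
    unfolding lead_mono_def by blast+
qed

end

theory Submission
  imports Defs
begin

text \<open>
  The recursion makes \<open>\<theta>\<^sup>\<alpha>\<close> the leading monomial of \<open>G\<^sub>\<alpha>\<close>, and if \<open>\<alpha>\<close> breaks the ballot condition then so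
  do both strings it is reduced to, whence \<open>G\<^sub>\<alpha> \<in> I\<^sub>n\<close>. Conversely, a ballot sequence is a noncrossing
  matching of its ones with earlier zeros. The product of the differences \<open>\<theta>\<^sub>b - \<theta>\<^sub>a\<close> over the matched
  pairs \<open>a < b\<close> is orthogonal to \<open>I\<^sub>n\<close> and its lexicographically smallest monomial is that of the
  sequence, so no element of \<open>I\<^sub>n\<close> has this leading monomial. Finally, a sequence breaking the ballot
  condition is divisible by its prefix up to the first break, which breaks it only at its last one.
\<close>

section \<open>Products with monomials\<close>

lemma lookup_mono_mult:
  "Poly_Mapping.lookup (mono_mult A B x) C = (if A \<subseteq> C \<and> B = C - A then sort_sign A B * x else 0)"
  by (auto simp: mono_mult_def lookup_single when_def)

lemma lookup_wedge_single:
  "Poly_Mapping.lookup (wedge (Poly_Mapping.single A c) f) C =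
    (if A \<subseteq> C then sort_sign A (C - A) * (c * Poly_Mapping.lookup f (C - A)) else 0)"
proof -
  have "Poly_Mapping.lookup (wedge (Poly_Mapping.single A c) f) C =
      (\<Sum>B\<in>Poly_Mapping.keys f.
        if B = C - A then (if A \<subseteq> C then sort_sign A B * (c * Poly_Mapping.lookup f B) else 0) else 0)"
    by (subst wedge_superset[of "{A}" "Poly_Mapping.keys f"])
      (auto simp: lookup_sum lookup_mono_mult intro!: sum.cong)
  then show ?thesis
    by (simp add: sum.delta in_keys_iff)
qed

lemma sort_sign_single_left: "sort_sign {k} B = (- 1) ^ card {b \<in> B. b < k}"
proof -
  have "{(a, b). a \<in> {k} \<and> b \<in> B \<and> b < a} = Pair k ` {b \<in> B. b < k}" by auto
  moreover have "inj_on (Pair k) {b \<in> B. b < k}" by (simp add: inj_on_def)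
  ultimately show ?thesis by (simp only: sort_sign_def card_image)
qed

lemma sort_sign_single_right: "sort_sign A {k} = (- 1) ^ card {a \<in> A. k < a}"
proof -
  have "{(a, b). a \<in> A \<and> b \<in> {k} \<and> b < a} = (\<lambda>a. (a, k)) ` {a \<in> A. k < a}" by auto
  moreover have "inj_on (\<lambda>a. (a, k)) {a \<in> A. k < a}" by (simp add: inj_on_def)
  ultimately show ?thesis by (simp only: sort_sign_def card_image)
qed

text \<open>Each of the \<open>card A * card B\<close> pairs is an inversion for exactly one of the
  two orders of multiplication, because \<open>A\<close> and \<open>B\<close> are disjoint; the two
  inversion counts therefore add up to that product.\<close>

lemma sort_sign_swap:
  assumes "finite A" "finite B" "A \<inter> B = {}"
  shows "sort_sign A B = (- 1) ^ (card A * card B) * sort_sign B A"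
proof -
  let ?P = "{(a, b). a \<in> A \<and> b \<in> B \<and> b < a}" and ?Q = "{(b, a). b \<in> B \<and> a \<in> A \<and> a < b}"
  have "A \<times> B = ?P \<union> prod.swap ` ?Q"
    using assms(3) by (auto simp: image_iff intro: linorder_neqE_nat)
  moreover have "?P \<inter> prod.swap ` ?Q = {}" by auto
  moreover have "finite ?P" "finite ?Q"
    by (rule finite_subset[of _ "A \<times> B"] finite_subset[of _ "B \<times> A"]; use assms in auto)+
  ultimately have "card A * card B = card ?P + card ?Q"
    using card_Un_disjoint[of ?P "prod.swap ` ?Q"] card_image[OF inj_on_subset[OF inj_swap subset_UNIV], of ?Q]
    by (simp flip: card_cartesian_product)
  then show ?thesis by (simp add: sort_sign_def power_add mult.assoc flip: power_mult_distrib)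
qed

lemma lookup_wedge_var:
  "Poly_Mapping.lookup (wedge (Poly_Mapping.single {k} c) f) C =
    (if k \<in> C then (- 1) ^ card {b \<in> C. b < k} * c * Poly_Mapping.lookup f (C - {k}) else 0)"
proof -
  have "{b \<in> C - {k}. b < k} = {b \<in> C. b < k}" by auto
  then show ?thesis by (simp add: lookup_wedge_single sort_sign_single_left)
qed

lemma lookup_F_poly:
  "Poly_Mapping.lookup (F_poly n r) A = (if A \<subseteq> {1..n} \<and> card A = r then 1 else 0)"
proof -
  have "finite {A. A \<subseteq> {1..n} \<and> card A = r}"
    by (rule finite_subset[of _ "Pow {1..n}"]) auto
  then show ?thesis by (simp add: F_poly_def lookup_sum lookup_single when_def sum.delta')
qed

lemma keys_F_poly: "Poly_Mapping.keys (F_poly n r) = {A. A \<subseteq> {1..n} \<and> card A = r}"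
  by (simp add: set_eq_iff in_keys_iff lookup_F_poly)

text \<open>All monomials of \<open>F_poly n r\<close> have degree \<open>r\<close>, so they pass
  \<open>B\<close> with one common sign. This turns right multiples of a generator into left
  multiples.\<close>

lemma F_poly_swap_single:
  assumes "finite B"
  shows "wedge (F_poly n r) (Poly_Mapping.single B c) =
    wedge (Poly_Mapping.single B ((- 1) ^ (r * card B) * c)) (F_poly n r)"
proof -
  have "mono_mult A B c = mono_mult B A ((- 1) ^ (r * card B) * c)"
    if "A \<subseteq> {1..n}" "card A = r" for A
  proof (cases "A \<inter> B = {}")
    case True
    moreover have "finite A" using that finite_subset by blast
    ultimately show ?thesis using that assms sort_sign_swap[of A B]
      by (simp add: mono_mult_def Un_commute Int_commute mult_ac)
  qed (simp add: mono_mult_def Int_commute)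
  then show ?thesis
    unfolding F_poly_def wedge_sum_left wedge_sum_right wedge_single by (intro sum.cong) auto
qed


section \<open>The ideal\<close>

lemma ext_ring_carrier:
  "f \<in> carrier (ext_ring n) \<longleftrightarrow> (\<forall>A\<in>Poly_Mapping.keys f. A \<subseteq> {1..n})"
  by (simp add: ext_ring_def)

lemma ext_ring_simps [simp]:
  "f \<oplus>\<^bsub>ext_ring n\<^esub> g = f + g" "f \<otimes>\<^bsub>ext_ring n\<^esub> g = wedge f g" "\<zero>\<^bsub>ext_ring n\<^esub> = 0"
  by (simp_all add: ext_ring_def)

lemma ext_ring_uminus_closed: "f \<in> carrier (ext_ring n) \<Longrightarrow> - f \<in> carrier (ext_ring n)"
  by (simp add: ext_ring_carrier in_keys_iff)

lemma ext_ring_minus: "f \<in> carrier (ext_ring n) \<Longrightarrow> \<ominus>\<^bsub>ext_ring n\<^esub> f = - f"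
proof -
  interpret ring "ext_ring n" by (rule ring_ext_ring)
  assume f: "f \<in> carrier (ext_ring n)"
  with ext_ring_uminus_closed[OF f] show "\<ominus>\<^bsub>ext_ring n\<^esub> f = - f"
    by (intro minus_equality) simp_all
qed

lemma single_in_carrier: "A \<subseteq> {1..n} \<Longrightarrow> Poly_Mapping.single A c \<in> carrier (ext_ring n)"
  by (simp add: ext_ring_carrier)

lemma F_poly_in_carrier: "F_poly n r \<in> carrier (ext_ring n)"
  by (simp add: ext_ring_carrier keys_F_poly)

lemma I_ideal: "ideal (I_ideal n) (ext_ring n)"
proof -
  interpret ring "ext_ring n" by (rule ring_ext_ring)
  show ?thesis unfolding I_ideal_def by (rule genideal_ideal) (auto simp: F_poly_in_carrier)
qed

lemma I_ideal_carrier: "f \<in> I_ideal n \<Longrightarrow> A \<in> Poly_Mapping.keys f \<Longrightarrow> A \<subseteq> {1..n}"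
  using ideal.Icarr[OF I_ideal, of f n] by (simp add: ext_ring_carrier)

lemma F_poly_in_I_ideal:
  assumes "1 \<le> r" "r \<le> n"
  shows "F_poly n r \<in> I_ideal n"
proof -
  interpret ring "ext_ring n" by (rule ring_ext_ring)
  have "{F_poly n r | r. 1 \<le> r \<and> r \<le> n} \<subseteq> I_ideal n"
    unfolding I_ideal_def by (rule genideal_self) (auto simp: F_poly_in_carrier)
  with assms show ?thesis by blast
qed

lemma I_ideal_diff:
  assumes "f \<in> I_ideal n" "g \<in> I_ideal n"
  shows "f - g \<in> I_ideal n"
proof -
  interpret ideal "I_ideal n" "ext_ring n" by (rule I_ideal)
  have "f \<oplus>\<^bsub>ext_ring n\<^esub> (\<ominus>\<^bsub>ext_ring n\<^esub> g) \<in> I_ideal n"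
    using assms a_inv_closed a_closed by blast
  then show ?thesis using ext_ring_minus[OF Icarr[OF assms(2)]] by simp
qed

lemma I_ideal_wedge_var:
  assumes "f \<in> I_ideal n" "1 \<le> k" "k \<le> n"
  shows "wedge (Poly_Mapping.single {k} c) f \<in> I_ideal n"
proof -
  interpret ideal "I_ideal n" "ext_ring n" by (rule I_ideal)
  have "Poly_Mapping.single {k} c \<in> carrier (ext_ring n)"
    using assms by (intro single_in_carrier) simp
  from I_l_closed[OF assms(1) this] show ?thesis by simp
qed

lemma wedge_expand_left:
  "wedge f g = (\<Sum>A\<in>Poly_Mapping.keys f. wedge (Poly_Mapping.single A (Poly_Mapping.lookup f A)) g)"
  using arg_cong[OF ext_expand[of f], of "\<lambda>f. wedge f g"] by (simp only: wedge_sum_left)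

lemma wedge_expand_right:
  "wedge g f = (\<Sum>A\<in>Poly_Mapping.keys f. wedge g (Poly_Mapping.single A (Poly_Mapping.lookup f A)))"
  using arg_cong[OF ext_expand[of f], of "wedge g"] by (simp only: wedge_sum_right)

lemma wedge_uminus: "wedge (- f) g = - wedge f g" "wedge g (- f) = - wedge g f"
  using wedge_add_left[of "- f" f g] wedge_add_right[of g "- f" f]
  by (simp_all add: eq_neg_iff_add_eq_0)

text \<open>The generators commute with monomials up to sign, so left multiples suffice.\<close>

lemma additive_vanishes_on_I_ideal:
  fixes \<phi> :: "ext \<Rightarrow> 'a :: ab_group_add"
  assumes add: "\<And>f g. \<phi> (f + g) = \<phi> f + \<phi> g"
    and gen: "\<And>C c r. C \<subseteq> {1..n} \<Longrightarrow> 1 \<le> r \<Longrightarrow> r \<le> n \<Longrightarrow>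
      \<phi> (wedge (Poly_Mapping.single C c) (F_poly n r)) = 0"
    and f: "f \<in> I_ideal n"
  shows "\<phi> f = 0"
proof -
  interpret ring "ext_ring n" by (rule ring_ext_ring)
  let ?C = "carrier (ext_ring n)"
  have zero: "\<phi> 0 = 0" using add[of 0 0] by simp
  have neg: "\<phi> (- f) = - \<phi> f" for f using group_add_class.minus_unique[of "\<phi> f" "\<phi> (- f)"] add[of f "- f"] zero by simp
  have sum: "\<phi> (\<Sum>i\<in>X. g i) = (\<Sum>i\<in>X. \<phi> (g i))" for g :: "nat set \<Rightarrow> ext" and X
    by (induction X rule: infinite_finite_induct) (auto simp: zero add)
  have fin: "finite A" if "A \<subseteq> {1..n}" for A using that finite_subset by blast
  \<comment> \<open>The ring is not commutative, so multiples on both sides are built in: this makes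
    \<open>J\<close> a two-sided ideal. It contains the generators, hence \<open>I_ideal n\<close>,
    and the multipliers \<open>a = b = 1\<close> give the claim.\<close>
  define J where "J = {f \<in> ?C. \<forall>a\<in>?C. \<forall>b\<in>?C. \<phi> (wedge (wedge a f) b) = 0}"
  have J: "ideal J (ext_ring n)"
  proof (rule idealI[OF ring_ext_ring])
    show "subgroup J (add_monoid (ext_ring n))"
    proof (rule group.subgroupI[OF a_group])
      have "0 \<in> J" using zero_closed by (simp add: J_def zero)
      then show "J \<noteq> {}" by blast
      fix x assume x: "x \<in> J"
      have "inv\<^bsub>add_monoid (ext_ring n)\<^esub> x = - x"
        using x ext_ring_minus[of x n] by (simp add: J_def a_inv_def)
      moreover have "- x \<in> ?C" using x ext_ring_uminus_closed by (simp add: J_def)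
      ultimately show "inv\<^bsub>add_monoid (ext_ring n)\<^esub> x \<in> J" using x
        by (simp add: J_def neg wedge_uminus)
    next
      fix x y assume "x \<in> J" "y \<in> J"
      then show "x \<otimes>\<^bsub>add_monoid (ext_ring n)\<^esub> y \<in> J"
        using add.m_closed[of x y] by (simp add: J_def wedge_add_left wedge_add_right add)
    qed (simp add: J_def subset_iff)
  next
    fix x y assume x: "x \<in> J" and y: "y \<in> ?C"
    have xC: "x \<in> ?C" using x by (simp add: J_def)
    have "\<phi> (wedge (wedge a (wedge y x)) b) = 0" if "a \<in> ?C" "b \<in> ?C" for a b
    proof -
      have "wedge a (wedge y x) = wedge (wedge a y) x"
        using m_assoc[OF that(1) y xC] by simp
      then show ?thesis using x m_closed[OF that(1) y] that(2) unfolding J_def by simp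
    qed
    moreover have "wedge y x \<in> ?C" using m_closed[OF y xC] by simp
    ultimately show "y \<otimes>\<^bsub>ext_ring n\<^esub> x \<in> J" unfolding J_def by simp
    have "\<phi> (wedge (wedge a (wedge x y)) b) = 0" if "a \<in> ?C" "b \<in> ?C" for a b
    proof -
      have "wedge (wedge a (wedge x y)) b = wedge (wedge a x) (wedge y b)"
        using m_assoc[OF that(1) xC y] m_assoc[OF _ y that(2), of "wedge a x"]
          m_closed[OF that(1) xC] by simp
      then show ?thesis using x m_closed[OF y that(2)] that(1) unfolding J_def by simp
    qed
    moreover have "wedge x y \<in> ?C" using m_closed[OF xC y] by simp
    ultimately show "x \<otimes>\<^bsub>ext_ring n\<^esub> y \<in> J" unfolding J_def by simp
  qed
  have "F_poly n r \<in> J" if r: "1 \<le> r" "r \<le> n" for r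
  proof -
    have "\<phi> (wedge (wedge (Poly_Mapping.single A x) (F_poly n r)) (Poly_Mapping.single B y)) = 0"
      if AB: "A \<subseteq> {1..n}" "B \<subseteq> {1..n}" for A B x y
    proof -
      let ?y = "(- 1) ^ (r * card B) * y"
      have "wedge (wedge (Poly_Mapping.single A x) (F_poly n r)) (Poly_Mapping.single B y)
          = wedge (Poly_Mapping.single A x) (wedge (F_poly n r) (Poly_Mapping.single B y))"
        using AB by (intro wedge_assoc) (auto simp: keys_F_poly fin split: if_splits)
      also have "\<dots> = wedge (Poly_Mapping.single A x)
          (wedge (Poly_Mapping.single B ?y) (F_poly n r))"
        using AB by (simp add: F_poly_swap_single fin)
      also have "\<dots> = wedge (wedge (Poly_Mapping.single A x) (Poly_Mapping.single B ?y)) (F_poly n r)"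
        using AB by (intro wedge_assoc[symmetric]) (auto simp: keys_F_poly fin split: if_splits)
      also have "\<phi> \<dots> = 0"
        using AB r by (auto simp: wedge_single mono_mult_def zero intro!: gen)
      finally show ?thesis .
    qed
    then have "\<phi> (wedge (wedge a (F_poly n r)) b) = 0" if "a \<in> ?C" "b \<in> ?C" for a b
      using that
      unfolding wedge_expand_right[of _ b] wedge_expand_left[of a] wedge_sum_left sum
      by (intro sum.neutral ballI) (simp add: ext_ring_carrier)
    then show ?thesis unfolding J_def by (simp add: F_poly_in_carrier)
  qed
  then have "I_ideal n \<subseteq> J"
    unfolding I_ideal_def by (intro genideal_minimal[OF J]) blast
  with f have fJ: "f \<in> J" by blast
  have one: "Poly_Mapping.single {} 1 \<in> ?C" by (intro single_in_carrier) simp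
  from fJ have "\<phi> (wedge (wedge (Poly_Mapping.single {} 1) f) (Poly_Mapping.single {} 1)) = 0"
    using one unfolding J_def by blast
  then show ?thesis by (simp add: wedge_one)
qed

section \<open>Noncrossing matchings\<close>

text \<open>Every closing position \<open>b\<close> is matched with the opening position \<open>opn b\<close>.\<close>

locale noncrossing_matching =
  fixes n :: nat and B :: "nat set" and opn :: "nat \<Rightarrow> nat"
  assumes close_range: "B \<subseteq> {1..n}"
    and open_range: "opn ` B \<subseteq> {1..n}"
    and inj: "inj_on opn B"
    and disj: "opn ` B \<inter> B = {}"
    and open_less: "b \<in> B \<Longrightarrow> opn b < b"
    and nested: "b \<in> B \<Longrightarrow> b' \<in> B \<Longrightarrow> opn b < b' \<Longrightarrow> b' < b \<Longrightarrow> opn b < opn b'"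
begin

text \<open>The mirror image of \<open>nested\<close>, starting from the opening end: if
  \<open>b'\<close> lay beyond \<open>b\<close>, then \<open>b\<close> would lie under the arc of
  \<open>b'\<close>, and \<open>nested\<close> with the arcs exchanged would force
  \<open>opn b' < opn b\<close>.\<close>

lemma nested': "b \<in> B \<Longrightarrow> b' \<in> B \<Longrightarrow> opn b < opn b' \<Longrightarrow> opn b' < b \<Longrightarrow> b' < b"
  using nested[of b' b] by (metis linorder_neqE_nat order_less_asym)

lemma finite_close: "finite B"
  using close_range finite_subset by blast

text \<open>These are the monomials of the product of the differences \<theta>_b - \<theta>_(opn b):
  \<open>S\<close> records the pairs from which the closing variable is chosen.\<close>

definition transversal :: "nat set \<Rightarrow> nat set" where
  "transversal S = S \<union> opn ` (B - S)"

text \<open>The number of pairs nested inside the arc of \<open>b\<close>: by \<open>nested\<close>,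
  a closing position under the arc has its opening position there too.\<close>

definition depth :: "nat \<Rightarrow> nat" where
  "depth b = card {b' \<in> B. opn b < b' \<and> b' < b}"

text \<open>The coefficient of the monomial \<open>transversal S\<close> in the product of
  differences: a chosen opening variable brings the minus sign of its difference and the sign of
  moving it into place. The value at \<open>S = B\<close> is 1.\<close>

definition weight :: "nat set \<Rightarrow> rat" where
  "weight S = (\<Prod>b\<in>B - S. - ((- 1) ^ depth b))"

text \<open>The pairing with the product over \<open>b \<in> B\<close> of \<open>\<theta>\<^sub>b - \<theta>\<^bsub>opn b\<^esub>\<close>: moving \<open>\<theta>\<^bsub>opn b\<^esub>\<close> to the place of
  \<open>\<theta>\<^sub>b\<close> passes exactly one factor for each pair nested inside.\<close>

definition pairing :: "ext \<Rightarrow> rat" where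
  "pairing f = (\<Sum>S\<in>Pow B. weight S * Poly_Mapping.lookup f (transversal S))"

lemma pairing_add: "pairing (f + g) = pairing f + pairing g"
  by (simp add: pairing_def lookup_add distrib_left sum.distrib)

lemma transversal_range: "S \<subseteq> B \<Longrightarrow> transversal S \<subseteq> {1..n}"
  using close_range open_range by (auto simp: transversal_def)

lemma finite_transversal: "S \<subseteq> B \<Longrightarrow> finite (transversal S)"
  using transversal_range by (rule finite_subset) simp_all

text \<open>The first difference is at the least opening position \<open>j\<close> that is chosen.
  Every closing position that it or another opening position replaces lies beyond \<open>j\<close>,
  so below \<open>j\<close> the two sets agree.\<close>

lemma lex_less_transversal:
  assumes "S \<subseteq> B" "S \<noteq> B"
  shows "lex_less B (transversal S)"
proof -
  define j where "j = Min (opn ` (B - S))"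
  have fin: "finite (opn ` (B - S))" using finite_close by auto
  have ne: "opn ` (B - S) \<noteq> {}" using assms by auto
  have j: "j \<in> opn ` (B - S)" unfolding j_def by (rule Min_in[OF fin ne])
  have le: "j \<le> opn b" if "b \<in> B - S" for b unfolding j_def using fin that by (auto intro: Min_le)
  have "\<forall>i<j. i \<in> B \<longleftrightarrow> i \<in> transversal S"
  proof (intro allI impI iffI)
    fix i assume i: "i < j" "i \<in> B"
    have "i \<in> S"
    proof (rule ccontr)
      assume "i \<notin> S"
      then show False using le[of i] open_less[of i] i by auto
    qed
    then show "i \<in> transversal S" by (simp add: transversal_def)
  next
    fix i assume "i < j" "i \<in> transversal S"
    then show "i \<in> B" using le assms by (fastforce simp: transversal_def)
  qed
  moreover have "j \<notin> B" "j \<in> transversal S" using j disj by (auto simp: transversal_def)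
  ultimately show ?thesis unfolding lex_less_def by blast
qed

lemma open_not_close: "b \<in> B \<Longrightarrow> opn b \<notin> B"
  using disj by blast

lemma close_in_transversal: "S \<subseteq> B \<Longrightarrow> b \<in> B \<Longrightarrow> b \<in> transversal S \<longleftrightarrow> b \<in> S"
  unfolding transversal_def using disj by blast

lemma open_in_transversal:
  assumes "S \<subseteq> B" "b \<in> B"
  shows "opn b \<in> transversal S \<longleftrightarrow> b \<notin> S"
proof -
  have "opn b \<in> opn ` (B - S) \<longleftrightarrow> b \<in> B - S"
    using assms inj by (intro inj_on_image_mem_iff) auto
  moreover have "opn b \<notin> S" using assms open_not_close by blast
  ultimately show ?thesis using assms by (simp add: transversal_def)
qed

lemma transversal_pair:
  assumes "S \<subseteq> B" "b \<in> B"
  shows "\<not> (b \<in> transversal S \<and> opn b \<in> transversal S)"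
  using assms by (simp add: close_in_transversal open_in_transversal)

text \<open>Every pair nested inside the arc of \<open>b\<close> meets \<open>C\<close>: at least
  once by \<open>covered\<close>, and at most once since \<open>C\<close> lies in a transversal. As
  the matching is noncrossing, these points are precisely the elements of \<open>C\<close> under the
  arc.\<close>

lemma card_covered_between:
  assumes S: "S \<subseteq> B" and C: "C \<subseteq> transversal S" and b: "b \<in> B" "b \<notin> C" "opn b \<notin> C"
    and covered: "\<And>b'. b' \<in> B \<Longrightarrow> b' < b \<Longrightarrow> b' \<in> C \<or> opn b' \<in> C"
  shows "card {a \<in> C. opn b < a \<and> a < b} = depth b"
proof -
  \<comment> \<open>The end of the pair of \<open>b'\<close> that \<open>transversal S\<close>
    contains.\<close>
  define h where "h b' = (if b' \<in> S then b' else opn b')" for b'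
  have "bij_betw h {b' \<in> B. opn b < b' \<and> b' < b} {a \<in> C. opn b < a \<and> a < b}"
    unfolding bij_betw_def
  proof
    show "inj_on h {b' \<in> B. opn b < b' \<and> b' < b}"
    proof (rule inj_onI)
      fix x y assume *: "x \<in> {b' \<in> B. opn b < b' \<and> b' < b}" "y \<in> {b' \<in> B. opn b < b' \<and> b' < b}" "h x = h y"
      then have "x \<in> B" "y \<in> B" by simp_all
      with * show "x = y"
        using open_not_close[of x] open_not_close[of y] inj_onD[OF inj, of x y]
        by (simp add: h_def split: if_splits)
    qed
    show "h ` {b' \<in> B. opn b < b' \<and> b' < b} = {a \<in> C. opn b < a \<and> a < b}"
    proof (rule equalityI; rule subsetI)
      fix a assume "a \<in> h ` {b' \<in> B. opn b < b' \<and> b' < b}"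
      then obtain b' where b': "b' \<in> B" "opn b < b'" "b' < b" "a = h b'" by blast
      have "a \<in> C"
        using covered[OF b'(1,3)]
      proof
        assume c: "b' \<in> C"
        with C have "b' \<in> S" using close_in_transversal[OF S b'(1)] by blast
        with c show ?thesis by (simp add: b'(4) h_def)
      next
        assume c: "opn b' \<in> C"
        with C have "b' \<notin> S" using open_in_transversal[OF S b'(1)] by blast
        with c show ?thesis by (simp add: b'(4) h_def)
      qed
      moreover have "opn b < opn b'" using nested[OF b(1) b'(1-3)] .
      ultimately show "a \<in> {a \<in> C. opn b < a \<and> a < b}"
        using b'(2,3) open_less[OF b'(1)] by (simp add: b'(4) h_def)
    next
      fix a assume a: "a \<in> {a \<in> C. opn b < a \<and> a < b}"
      with C have "a \<in> transversal S" by blast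
      then consider "a \<in> S" | b' where "b' \<in> B - S" "a = opn b'"
        unfolding transversal_def by blast
      then show "a \<in> h ` {b' \<in> B. opn b < b' \<and> b' < b}"
      proof cases
        case 1
        with a S have "a \<in> {b' \<in> B. opn b < b' \<and> b' < b}" "h a = a" by (auto simp: h_def)
        then show ?thesis by (intro image_eqI[of a h a]) simp_all
      next
        case 2
        then have "b' < b" using a nested'[OF b(1), of b'] by auto
        moreover have "opn b < b'" using 2 a open_less[of b'] by auto
        ultimately have "b' \<in> {b' \<in> B. opn b < b' \<and> b' < b}" "h b' = a"
          using 2 by (auto simp: h_def)
        then show ?thesis by (intro image_eqI[of a h b']) simp_all
      qed
    qed
  qed
  then show ?thesis unfolding depth_def by (rule bij_betw_same_card[symmetric])
qed

text \<open>Exchanging \<open>b\<close> and \<open>opn b\<close>, for the least \<open>b\<close> such that \<open>C\<close> meets neither, is a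
  sign-reversing involution on the terms of the sum.\<close>

lemma pairing_multiple_F_poly:
  assumes r: "r \<ge> 1"
  shows "pairing (wedge (Poly_Mapping.single C c) (F_poly n r)) = 0"
proof (cases "\<exists>S\<subseteq>B. C \<subseteq> transversal S \<and> card (transversal S - C) = r")
  case False
  then show ?thesis unfolding pairing_def
    by (intro sum.neutral) (auto simp: lookup_wedge_single lookup_F_poly)
next
  case True
  let ?t = "\<lambda>S. weight S *
    Poly_Mapping.lookup (wedge (Poly_Mapping.single C c) (F_poly n r)) (transversal S)"
  define free where "free b \<longleftrightarrow> b \<in> B \<and> b \<notin> C \<and> opn b \<notin> C" for b
  obtain S where S: "S \<subseteq> B" "C \<subseteq> transversal S" "card (transversal S - C) = r" using True by auto
  have finC: "finite C" by (rule finite_subset[OF S(2) finite_transversal[OF S(1)]])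
  \<comment> \<open>Positive degree enters here: the complementary factor from
    \<open>F_poly n r\<close> is not 1, so some pair is met by the transversal outside
    \<open>C\<close>, and hence not met by \<open>C\<close> at all.\<close>
  have "transversal S - C \<noteq> {}" using S(3) r by (metis card.empty not_one_le_zero)
  then obtain x where "x \<in> transversal S" "x \<notin> C" by blast
  then have "\<exists>b. free b"
  proof -
    from \<open>x \<in> transversal S\<close> obtain b where b: "b \<in> B" "x = b \<or> x = opn b"
      using S(1) by (auto simp: transversal_def)
    with S(2) \<open>x \<in> transversal S\<close> \<open>x \<notin> C\<close> have "free b"
      using transversal_pair[OF S(1) b(1)] unfolding free_def by blast
    then show ?thesis by blast
  qed
  \<comment> \<open>Taking the least free \<open>b\<close> guarantees that \<open>C\<close> meets
    every pair that closes earlier, in particular every pair nested inside that of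
    \<open>b\<close>.\<close>
  define b where "b = (LEAST b. free b)"
  have "free b" unfolding b_def by (rule LeastI_ex) fact
  then have b: "b \<in> B" "b \<notin> C" "opn b \<notin> C" by (auto simp: free_def)
  have covered: "b' \<in> C \<or> opn b' \<in> C" if "b' \<in> B" "b' < b" for b'
    using not_less_Least[of b' free] that unfolding b_def free_def by auto
  have "?t S + ?t (insert b S) = 0" if S: "S \<subseteq> B - {b}" for S
  proof -
    define R where "R = transversal (insert b S) - {b}"
    have T1: "transversal (insert b S) = insert b R" by (auto simp: R_def transversal_def)
    have bR: "b \<notin> R" by (simp add: R_def)
    have oR: "opn b \<notin> R"
      using b(1) S by (simp add: R_def open_in_transversal subset_iff)
    have T0: "transversal S = insert (opn b) R"
    proof -
      have "b \<notin> opn ` B" "b \<notin> S" using b(1) disj S by blast+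
      then show ?thesis using b(1) by (auto simp: R_def transversal_def)
    qed
    have SB: "S \<subseteq> B" "insert b S \<subseteq> B" using S b by auto
    have range: "transversal S \<subseteq> {1..n}" "transversal (insert b S) \<subseteq> {1..n}"
      using SB transversal_range by blast+
    have finR: "finite R" unfolding R_def using finite_transversal[OF SB(2)] by simp
    have w: "weight S = - ((- 1) ^ depth b) * weight (insert b S)"
    proof -
      have "B - S = insert b (B - insert b S)" using b S by blast
      then have "weight S = (\<Prod>b\<in>insert b (B - insert b S). - ((- 1) ^ depth b))"
        by (simp only: weight_def)
      also have "\<dots> = - ((- 1) ^ depth b) * weight (insert b S)"
        unfolding weight_def using finite_close by (intro prod.insert) auto
      finally show ?thesis .
    qed
    show ?thesis
    proof (cases "C \<subseteq> R")
      case False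
      then have "\<not> C \<subseteq> transversal S" "\<not> C \<subseteq> transversal (insert b S)" using b by (auto simp: T0 T1)
      then show ?thesis by (simp add: lookup_wedge_single)
    next
      case C: True
      have sgn: "sort_sign C (insert x (R - C)) = sort_sign C (R - C) * (- 1) ^ card {a \<in> C. x < a}"
        if "x \<notin> R" for x
        using sort_sign_Un_right[of "R - C" "{x}" C] that finR finC
        by (simp add: sort_sign_single_right)
      \<comment> \<open>Inserting \<open>opn b\<close> instead of \<open>b\<close> costs one more
        sign for each element of \<open>C\<close> strictly between them. There are
        \<open>depth b\<close> of these, so this cancels the power of -1 in \<open>w\<close> and
        leaves two opposite terms.\<close>
      have "opn b < a \<longleftrightarrow> (opn b < a \<and> a < b) \<or> b < a" if "a \<in> C" for a
      proof -
        have "a \<noteq> b" using that b by blast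
        then show ?thesis using open_less[OF b(1)] by linarith
      qed
      then have "{a \<in> C. opn b < a} = {a \<in> C. opn b < a \<and> a < b} \<union> {a \<in> C. b < a}" by blast
      moreover have "{a \<in> C. opn b < a \<and> a < b} \<inter> {a \<in> C. b < a} = {}" by auto
      ultimately have "card {a \<in> C. opn b < a} = card {a \<in> C. opn b < a \<and> a < b} + card {a \<in> C. b < a}"
        using finC by (simp add: card_Un_disjoint)
      also have "card {a \<in> C. opn b < a \<and> a < b} = depth b"
        using C covered b SB(1) by (intro card_covered_between[of S]) (auto simp: T0)
      finally have cnt: "card {a \<in> C. opn b < a} = depth b + card {a \<in> C. b < a}" .
      have sub: "C \<subseteq> insert b R" "C \<subseteq> insert (opn b) R" using C by blast+
      have "insert (opn b) (R - C) \<subseteq> {1..n}" "insert b (R - C) \<subseteq> {1..n}"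
        using range unfolding T0 T1 by blast+
      then have "Poly_Mapping.lookup (F_poly n r) (insert (opn b) (R - C))
          = Poly_Mapping.lookup (F_poly n r) (insert b (R - C))"
        using finR bR oR by (simp add: lookup_F_poly)
      then show ?thesis
        using sub b by (simp add: T0 T1 lookup_wedge_single insert_Diff_if sgn[OF bR] sgn[OF oR] w cnt power_add)
    qed
  qed
  moreover have "pairing (wedge (Poly_Mapping.single C c) (F_poly n r))
      = (\<Sum>S\<in>Pow (B - {b}). ?t S + ?t (insert b S))"
  proof -
    \<comment> \<open>The subsets of \<open>B\<close> are grouped into pairs \<open>S\<close>,
      \<open>insert b S\<close>, which is the involution.\<close>
    have "Pow B = Pow (B - {b}) \<union> insert b ` Pow (B - {b})"
      using b(1) Pow_insert[of b "B - {b}"] by (simp add: insert_absorb)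
    moreover have "Pow (B - {b}) \<inter> insert b ` Pow (B - {b}) = {}" by auto
    moreover have "inj_on (insert b) (Pow (B - {b}))" by (auto simp: inj_on_def)
    ultimately show ?thesis unfolding pairing_def using finite_close
      by (simp add: sum.union_disjoint sum.reindex sum.distrib)
  qed
  ultimately show ?thesis by simp
qed

text \<open>If \<open>B\<close> were leading, no larger monomial would occur in \<open>f\<close>, in
  particular no other transversal. The pairing would then be the coefficient of \<open>B\<close>
  with weight 1, which is nonzero, although the pairing vanishes on the ideal.\<close>

lemma lead_mono_I_ideal_neq:
  assumes "f \<in> I_ideal n" "f \<noteq> 0"
  shows "lead_mono f \<noteq> B"
proof
  assume L: "lead_mono f = B"
  have "Poly_Mapping.lookup f (transversal S) = 0" if S: "S \<in> Pow B - {B}" for S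
  proof (rule ccontr)
    assume "Poly_Mapping.lookup f (transversal S) \<noteq> 0"
    then have "transversal S \<in> Poly_Mapping.keys f" by (simp add: in_keys_iff)
    moreover have "lex_less B (transversal S)" using S by (intro lex_less_transversal) auto
    ultimately show False using lead_mono_props(2)[OF assms(2), of "transversal S"] L
      by (metis lex_less_asym)
  qed
  moreover have "pairing f = 0"
    by (rule additive_vanishes_on_I_ideal[OF _ _ assms(1)])
      (auto simp: pairing_add pairing_multiple_F_poly)
  ultimately have "weight B * Poly_Mapping.lookup f (transversal B) = 0"
    unfolding pairing_def using finite_close by (subst (asm) sum.remove[of _ B]) auto
  then show False using lead_mono_props(1)[OF assms(2)] L
    by (simp add: weight_def transversal_def in_keys_iff)
qed

end


section \<open>Ballot sequences and matchings\<close>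

text \<open>The key that represents the monomial \<open>\<theta>\<^sup>\<alpha>\<close>.\<close>

definition ones :: "bool list \<Rightarrow> nat set" where
  "ones \<alpha> = {i. 1 \<le> i \<and> i \<le> length \<alpha> \<and> \<alpha> ! (i - 1)}"

lemma ones_range: "ones \<alpha> \<subseteq> {1..length \<alpha>}"
  by (auto simp: ones_def)

lemma finite_ones: "finite (ones \<alpha>)"
  using ones_range by (rule finite_subset) simp

lemma ones_Nil [simp]: "ones [] = {}"
  by (auto simp: ones_def)

lemma ones_Cons: "ones (x # \<alpha>) = (if x then insert 1 (Suc ` ones \<alpha>) else Suc ` ones \<alpha>)"
proof -
  have "i \<in> ones (x # \<alpha>) \<longleftrightarrow> i \<in> (if x then insert 1 (Suc ` ones \<alpha>) else Suc ` ones \<alpha>)" for i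
  proof (cases i rule: nat.exhaust)
    case (Suc j)
    then show ?thesis by (cases j) (auto simp: ones_def)
  qed (auto simp: ones_def)
  then show ?thesis by blast
qed

lemma ones_snoc: "ones (\<alpha> @ [x]) = (if x then insert (Suc (length \<alpha>)) (ones \<alpha>) else ones \<alpha>)"
  by (auto simp: ones_def nth_append le_Suc_eq)

lemma ones_take: "ones (take r \<alpha>) = ones \<alpha> \<inter> {..r}"
  by (auto simp: ones_def)

lemma ones_append_zeros: "ones (\<alpha> @ replicate t False) = ones \<alpha>"
  by (induction t) (simp_all add: replicate_append_same[symmetric] ones_snoc flip: append_assoc)

lemma ones_inject: "length \<alpha> = length \<beta> \<Longrightarrow> ones \<alpha> = ones \<beta> \<Longrightarrow> \<alpha> = \<beta>"
proof (rule nth_equalityI)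
  fix i assume "length \<alpha> = length \<beta>" "ones \<alpha> = ones \<beta>" "i < length \<alpha>"
  then have "Suc i \<in> ones \<alpha> \<longleftrightarrow> Suc i \<in> ones \<beta>" "i < length \<beta>" by simp_all
  with \<open>i < length \<alpha>\<close> show "\<alpha> ! i = \<beta> ! i" by (simp add: ones_def)
qed

lemma ones_surj:
  assumes "L \<subseteq> {1..n}"
  obtains \<alpha> where "length \<alpha> = n" "ones \<alpha> = L"
proof
  show "length (map (\<lambda>i. Suc i \<in> L) [0..<n]) = n" by simp
  show "ones (map (\<lambda>i. Suc i \<in> L) [0..<n]) = L"
    using assms by (fastforce simp: ones_def)
qed

lemma m1_simps [simp]:
  "m1 [] = 0" "m1 (x # u) = (if x then Suc (m1 u) else m1 u)" "m1 (u @ v) = m1 u + m1 v"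
  by (simp_all add: m1_def)

lemma m1_replicate [simp]: "m1 (replicate s x) = (if x then s else 0)"
  by (induction s) auto

lemma card_ones: "card (ones \<alpha>) = m1 \<alpha>"
proof (induction \<alpha>)
  case (Cons x \<alpha>)
  have "1 \<notin> Suc ` ones \<alpha>" using ones_range[of \<alpha>] by auto
  with Cons show ?case by (simp add: ones_Cons finite_ones card_image)
qed simp

lemma m1_take: "m1 (take r \<alpha>) = card (ones \<alpha> \<inter> {..r})"
  by (simp add: ones_take flip: card_ones)

lemma m1_take_Suc_le: "m1 (take (Suc r) \<alpha>) \<le> Suc (m1 (take r \<alpha>))"
proof (cases "r < length \<alpha>")
  case True
  then show ?thesis by (simp add: take_Suc_conv_app_nth)
qed simp

section \<open>Positions at which the ballot condition breaks\<close>

lemma breaks_ballot_at_iff: "breaks_ballot_at \<alpha> r \<longleftrightarrow> r < 2 * m1 (take r \<alpha>)"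
proof -
  have "breaks_ballot_at \<alpha> r \<longleftrightarrow> real r < real (2 * m1 (take r \<alpha>))"
    unfolding breaks_ballot_at_def by auto
  then show ?thesis by (simp only: of_nat_less_iff)
qed

text \<open>Admitting position 0 is harmless, since the empty prefix never breaks the condition; it
  spares a case distinction later.\<close>

lemma breaks_ballot_iff: "breaks_ballot \<alpha> \<longleftrightarrow> (\<exists>r\<le>length \<alpha>. r < 2 * m1 (take r \<alpha>))"
proof
  assume "\<exists>r\<le>length \<alpha>. r < 2 * m1 (take r \<alpha>)"
  then obtain r where r: "r \<le> length \<alpha>" "r < 2 * m1 (take r \<alpha>)" by blast
  then have "r \<noteq> 0" by (cases r) auto
  with r show "breaks_ballot \<alpha>" by (auto simp: breaks_ballot_def breaks_ballot_at_iff)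
qed (auto simp: breaks_ballot_def breaks_ballot_at_iff)

text \<open>\<open>\<beta>\<close> keeps \<open>\<alpha>\<close> up to its first break
  \<open>r\<close> and is zero afterwards. The letter at \<open>r\<close> is a 1, since a 0 could
  not cause the first break.\<close>

lemma first_break:
  assumes "breaks_ballot \<alpha>"
  obtains \<beta> where "length \<beta> = length \<alpha>" "breaks_ballot_only_at_rightmost_one \<beta>" "ones \<beta> \<subseteq> ones \<alpha>"
proof -
  define r where "r = (LEAST r. r \<le> length \<alpha> \<and> r < 2 * m1 (take r \<alpha>))"
  have "\<exists>r. r \<le> length \<alpha> \<and> r < 2 * m1 (take r \<alpha>)" using assms by (simp add: breaks_ballot_iff)
  then have "r \<le> length \<alpha> \<and> r < 2 * m1 (take r \<alpha>)" unfolding r_def by (rule LeastI_ex)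
  then have r: "r \<le> length \<alpha>" "r < 2 * m1 (take r \<alpha>)" by simp_all
  have before: "2 * m1 (take q \<alpha>) \<le> q" if "q < r" for q
    using not_less_Least[of q "\<lambda>r. r \<le> length \<alpha> \<and> r < 2 * m1 (take r \<alpha>)"] that r(1)
    by (simp add: r_def[symmetric] not_less)
  obtain q where q: "r = Suc q" using r(2) by (cases r) auto
  have step: "take r \<alpha> = take q \<alpha> @ [\<alpha> ! q]" using q r(1) by (simp add: take_Suc_conv_app_nth)
  have last: "\<alpha> ! q" using r(2) before[of q] q step by (cases "\<alpha> ! q") auto
  \<comment> \<open>The excess at the first break is exactly one, so the first zero appended after
    \<open>r\<close> already restores the condition.\<close>
  have cnt: "2 * m1 (take r \<alpha>) = Suc r" using r(2) before[of q] q step last by simp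
  define \<beta> where "\<beta> = take r \<alpha> @ replicate (length \<alpha> - r) False"
  have len: "length \<beta> = length \<alpha>" using r(1) by (simp add: \<beta>_def)
  have ones: "ones \<beta> = ones \<alpha> \<inter> {..r}" by (simp add: \<beta>_def ones_append_zeros ones_take)
  have "rightmost_one \<beta> r"
  proof -
    have "r \<in> ones \<beta>" unfolding ones using last q r(1) by (simp add: ones_def)
    moreover have "\<forall>i\<in>ones \<beta>. i \<le> r" unfolding ones by simp
    ultimately show ?thesis by (simp add: rightmost_one_def ones_def)
  qed
  moreover have "breaks_ballot_at \<beta> i \<longleftrightarrow> i = r" for i
  proof -
    have "m1 (take i \<beta>) = m1 (take (min i r) \<alpha>)"
      by (simp add: \<beta>_def take_replicate)
    then show ?thesis using before[of i] cnt r(2)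
      by (cases i r rule: linorder_cases) (simp_all add: breaks_ballot_at_iff)
  qed
  ultimately have "breaks_ballot_only_at_rightmost_one \<beta>"
    unfolding breaks_ballot_only_at_rightmost_one_def by blast
  with len ones that show thesis by blast
qed

text \<open>More ones can only help to break, so \<open>\<beta>\<close> breaks at the break
  \<open>p\<close> of \<open>\<alpha>\<close>, and its only break is \<open>p\<close> as well. Since
  \<open>\<beta>\<close> does not break just before \<open>p\<close>, it has at most (p+1)/2 ones,
  while \<open>\<alpha>\<close> has at least that many; inclusion then becomes equality.\<close>

lemma only_at_rightmost_one_antichain:
  assumes "breaks_ballot_only_at_rightmost_one \<alpha>" "breaks_ballot_only_at_rightmost_one \<beta>"
    and len: "length \<alpha> = length \<beta>" and sub: "ones \<alpha> \<subseteq> ones \<beta>"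
  shows "\<alpha> = \<beta>"
proof -
  obtain p where p: "rightmost_one \<alpha> p" "\<And>r. r \<in> {1..length \<alpha>} \<Longrightarrow> breaks_ballot_at \<alpha> r \<longleftrightarrow> r = p"
    using assms(1) unfolding breaks_ballot_only_at_rightmost_one_def by blast
  obtain q where q: "rightmost_one \<beta> q" "\<And>r. r \<in> {1..length \<beta>} \<Longrightarrow> breaks_ballot_at \<beta> r \<longleftrightarrow> r = q"
    using assms(2) unfolding breaks_ballot_only_at_rightmost_one_def by blast
  have pl: "p \<in> {1..length \<beta>}" using p(1) len by (simp add: rightmost_one_def)
  have pa: "p < 2 * m1 (take p \<alpha>)" using p(2)[of p] pl len by (simp add: breaks_ballot_at_iff)
  have "m1 (take p \<alpha>) \<le> m1 (take p \<beta>)"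
    unfolding m1_take using sub by (intro card_mono) (auto intro: finite_ones)
  with pa have "breaks_ballot_at \<beta> p" by (simp add: breaks_ballot_at_iff)
  with q(2)[OF pl] have pq: "p = q" by simp
  obtain p' where p': "p = Suc p'" using pl by (cases p) auto
  have "2 * m1 (take p' \<beta>) \<le> p'"
  proof (cases "p' = 0")
    case False
    with pl p' q(2)[of p'] pq show ?thesis by (simp add: breaks_ballot_at_iff)
  qed simp
  then have "2 * m1 (take p \<beta>) \<le> Suc p" using m1_take_Suc_le[of p' \<beta>] p' by simp
  moreover have "ones \<beta> \<inter> {..p} = ones \<beta>"
    using q(1) pq by (auto simp: rightmost_one_def ones_def)
  moreover have "card (ones \<alpha> \<inter> {..p}) \<le> card (ones \<alpha>)"
    by (intro card_mono finite_ones) simp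
  ultimately have "card (ones \<beta>) \<le> card (ones \<alpha>)" using pa by (simp add: m1_take)
  then have "ones \<alpha> = ones \<beta>" by (rule card_seteq[OF finite_ones sub])
  with len show ?thesis by (rule ones_inject)
qed

text \<open>Closing positions are matched greedily from left to right, each with the last unmatched opening
  position; the invariant that no unmatched position lies below a pair keeps the matching noncrossing.\<close>

lemma ballot_noncrossing_matching:
  assumes "\<not> breaks_ballot \<alpha>"
  shows "\<exists>opn. noncrossing_matching (length \<alpha>) (ones \<alpha>) opn"
proof -
  have "\<exists>opn. noncrossing_matching (length \<alpha>) (ones \<alpha>) opn \<and>
      (\<forall>u\<in>{1..length \<alpha>} - ones \<alpha> - opn ` ones \<alpha>. \<forall>b\<in>ones \<alpha>. \<not> (opn b < u \<and> u < b))"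
    if "\<forall>r\<le>length \<alpha>. 2 * m1 (take r \<alpha>) \<le> r"
    using that
  proof (induction \<alpha> rule: rev_induct)
    case Nil
    show ?case by (intro exI[of _ id]) (simp add: noncrossing_matching_def)
  next
    case (snoc x \<alpha>)
    let ?n = "length \<alpha>" and ?B = "ones \<alpha>"
    have "\<forall>r\<le>?n. 2 * m1 (take r \<alpha>) \<le> r"
    proof (intro allI impI)
      fix r assume "r \<le> ?n"
      with snoc.prems[rule_format, of r] show "2 * m1 (take r \<alpha>) \<le> r" by simp
    qed
    with snoc.IH obtain opn where m: "noncrossing_matching ?n ?B opn"
      and free: "\<And>u b. u \<in> {1..?n} - ?B - opn ` ?B \<Longrightarrow> b \<in> ?B \<Longrightarrow> \<not> (opn b < u \<and> u < b)"
      by blast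
    interpret noncrossing_matching ?n ?B opn by (rule m)
    show ?case
    proof (cases x)
      case False
      \<comment> \<open>A final 0 stays unmatched, to the right of all pairs.\<close>
      have "noncrossing_matching (Suc ?n) ?B opn"
      proof
        show "?B \<subseteq> {1..Suc ?n}" "opn ` ?B \<subseteq> {1..Suc ?n}"
          using close_range open_range by fastforce+
      qed (fact inj disj open_less nested)+
      moreover have "\<not> (opn b < u \<and> u < b)"
        if "u \<in> {1..Suc ?n} - ?B - opn ` ?B" "b \<in> ?B" for u b
      proof (cases "u = Suc ?n")
        case True
        then show ?thesis using that(2) close_range by force
      next
        case False
        then show ?thesis using that free[of u b] by simp
      qed
      ultimately show ?thesis using False by (intro exI[of _ opn]) (simp add: ones_snoc)
    next
      case True
      let ?U = "{1..?n} - ?B - opn ` ?B"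
      \<comment> \<open>The matched positions number twice the ones. The ballot condition at the new
        final 1 makes this less than \<open>?n\<close>, so an unmatched opening position is left for
        it.\<close>
      have "card (?B \<union> opn ` ?B) = 2 * m1 \<alpha>"
        using disj inj by (simp add: card_Un_disjoint finite_ones card_ones card_image Int_commute)
      moreover have "2 * m1 \<alpha> < ?n"
        using snoc.prems[rule_format, of "Suc ?n"] True by simp
      ultimately have "?B \<union> opn ` ?B \<noteq> {1..?n}" by (metis card_atLeastAtMost diff_Suc_1 less_irrefl)
      then have ne: "?U \<noteq> {}" using close_range open_range by blast
      define a where "a = Max ?U"
      have a: "a \<in> ?U" unfolding a_def using ne by (intro Max_in) auto
      have a_max: "u \<le> a" if "u \<in> ?U" for u unfolding a_def using that by (intro Max_ge) auto
      define opn' where "opn' = opn(Suc ?n := a)"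
      have new: "Suc ?n \<notin> ?B" using close_range by auto
      have opn'_old: "opn' b = opn b" if "b \<in> ?B" for b
        using that new by (auto simp: opn'_def)
      have opn'_new: "opn' (Suc ?n) = a" by (simp add: opn'_def)
      have img: "opn' ` insert (Suc ?n) ?B = insert a (opn ` ?B)"
        using opn'_old opn'_new by (auto simp: image_iff)
      have "noncrossing_matching (Suc ?n) (insert (Suc ?n) ?B) opn'"
      proof
        show "insert (Suc ?n) ?B \<subseteq> {1..Suc ?n}" using close_range by fastforce
        show "opn' ` insert (Suc ?n) ?B \<subseteq> {1..Suc ?n}"
          unfolding img using open_range a by fastforce
        have "inj_on opn' ?B" using inj opn'_old by (simp add: inj_on_def)
        moreover have "opn' ` ?B = opn ` ?B" using opn'_old by (simp add: image_def)
        ultimately show "inj_on opn' (insert (Suc ?n) ?B)"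
          using a new opn'_new by (simp add: inj_on_insert)
        have "Suc ?n \<notin> opn ` ?B" using open_range by auto
        then show "opn' ` insert (Suc ?n) ?B \<inter> insert (Suc ?n) ?B = {}"
          unfolding img using disj a new by auto
        fix b assume b: "b \<in> insert (Suc ?n) ?B"
        then show "opn' b < b" using a open_less opn'_old opn'_new by auto
        fix b' assume b': "b' \<in> insert (Suc ?n) ?B" "opn' b < b'" "b' < b"
        have "b \<le> Suc ?n" using b close_range by auto
        then have b'B: "b' \<in> ?B" using b' by auto
        show "opn' b < opn' b'"
        proof (cases "b = Suc ?n")
          case True
          \<comment> \<open>By the invariant the unmatched \<open>a\<close> is not below the old
            pair of \<open>b'\<close>; since \<open>b'\<close> lies beyond \<open>a\<close>, so does
            its opening position.\<close>
          have "\<not> opn b' < a" using free[OF a b'B] b' opn'_new True by auto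
          moreover have "opn b' \<noteq> a" using a b'B by auto
          ultimately show ?thesis using True opn'_new opn'_old[OF b'B] by simp
        next
          case False
          then have "b \<in> ?B" using b by simp
          then show ?thesis using nested[of b b'] b' b'B opn'_old by simp
        qed
      qed
      moreover have "\<not> (opn' b < u \<and> u < b)"
        if u: "u \<in> {1..Suc ?n} - insert (Suc ?n) ?B - insert a (opn ` ?B)"
          and b: "b \<in> insert (Suc ?n) ?B" for u b
      proof -
        have uU: "u \<in> ?U" using u by auto
        show ?thesis
        proof (cases "b = Suc ?n")
          case True
          then show ?thesis using a_max[OF uU] opn'_new by simp
        next
          case False
          then have "b \<in> ?B" using b by simp
          then show ?thesis using free[OF uU] opn'_old by simp
        qed
      qed
      ultimately show ?thesis using True img
        by (intro exI[of _ opn']) (simp add: ones_snoc)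
    qed
  qed
  moreover have "\<forall>r\<le>length \<alpha>. 2 * m1 (take r \<alpha>) \<le> r"
    using assms by (auto simp: breaks_ballot_iff not_less)
  ultimately show ?thesis by blast
qed


section \<open>Leading monomials\<close>

lemma G_poly_range:
  "A \<in> Poly_Mapping.keys (G_poly \<alpha>) \<Longrightarrow> A \<subseteq> {1..length \<alpha>}"
proof (induction \<alpha> arbitrary: A rule: G_poly.induct)
  case (1 s t)
  then show ?case by (simp add: keys_F_poly)
next
  case (2 s u t)
  let ?f = "G_poly (u @ replicate s True @ replicate (t + 1) False)"
    and ?g = "G_poly (u @ replicate (s - 1) True @ replicate (t + 2) False)"
  from 2 have "A \<in> Poly_Mapping.keys ?f \<or>
      A \<in> Poly_Mapping.keys (wedge (Poly_Mapping.single {length u + 1} ((- 1) ^ m1 u)) ?g)"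
    unfolding G_poly_step[OF 2(1)] in_keys_iff lookup_minus by auto
  then show ?case
  proof
    assume "A \<in> Poly_Mapping.keys ?f"
    then show ?thesis using 2 by simp
  next
    assume "A \<in> Poly_Mapping.keys (wedge (Poly_Mapping.single {length u + 1} ((- 1) ^ m1 u)) ?g)"
    then obtain D where "D \<in> Poly_Mapping.keys ?g" "A = {length u + 1} \<union> D"
      by (auto dest!: keys_wedge split: if_splits)
    moreover from this have "D \<subseteq> {1..length (u @ replicate (s - 1) True @ replicate (t + 2) False)}"
      using "2.IH"(2)[of D] by blast
    ultimately show ?thesis using 2(1) by auto
  qed
qed

lemma G_poly_Nil: "G_poly [] = F_poly 0 0"
  using G_poly_base[of 0 0] by simp

section \<open>Shifting all variables by one\<close>

lemma Suc_image_subset_iff: "0 \<notin> A \<Longrightarrow> Suc ` A \<subseteq> {1..Suc n} \<longleftrightarrow> A \<subseteq> {1..n}"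
  by (force simp: subset_iff Suc_le_eq intro!: Nat.gr0I)

text \<open>Splits monomials by whether \<theta>_1 occurs, for induction on strings from the
  left.\<close>

lemma nat_set_Suc_cases:
  assumes "0 \<notin> C"
  obtains A where "0 \<notin> A" "C = Suc ` A \<or> C = insert 1 (Suc ` A)"
proof
  let ?A = "{i. i \<noteq> 0 \<and> Suc i \<in> C}"
  have "i \<in> C \<longleftrightarrow> i = 1 \<and> 1 \<in> C \<or> i \<in> Suc ` ?A" for i
    using assms by (cases i; cases "i - 1") auto
  then show "C = Suc ` ?A \<or> C = insert 1 (Suc ` ?A)" by blast
qed simp

lemma Suc_image_less: "{b \<in> Suc ` A. b < Suc k} = Suc ` {b \<in> A. b < k}"
  by auto

lemma insert_Suc_image_less:
  "1 \<le> k \<Longrightarrow> {b \<in> insert 1 (Suc ` A). b < Suc k} = insert 1 (Suc ` {b \<in> A. b < k})"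
  by auto

lemma card_insert_Suc_image: "0 \<notin> A \<Longrightarrow> finite A \<Longrightarrow> card (insert 1 (Suc ` A)) = Suc (card A)"
  by (subst card_insert_disjoint) (auto simp: card_image)

lemma lookup_wedge_var_Suc_image:
  "Poly_Mapping.lookup (wedge (Poly_Mapping.single {Suc k} c) f) (Suc ` A) =
    (if k \<in> A then (- 1) ^ card {b \<in> A. b < k} * c * Poly_Mapping.lookup f (Suc ` (A - {k})) else 0)"
proof -
  have "Suc ` A - {Suc k} = Suc ` (A - {k})" by auto
  then show ?thesis
    unfolding lookup_wedge_var Suc_image_less by (simp add: card_image image_iff)
qed

text \<open>The extra minus sign arises because the shifted variable also has to pass
  \<theta>_1.\<close>

lemma lookup_wedge_var_insert_Suc_image:
  assumes "1 \<le> k" "0 \<notin> A"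
  shows "Poly_Mapping.lookup (wedge (Poly_Mapping.single {Suc k} c) f) (insert 1 (Suc ` A)) =
    (if k \<in> A then - ((- 1) ^ card {b \<in> A. b < k}) * c *
      Poly_Mapping.lookup f (insert 1 (Suc ` (A - {k}))) else 0)"
proof -
  have "insert 1 (Suc ` A) - {Suc k} = insert 1 (Suc ` (A - {k}))" using assms by auto
  moreover have "card (insert 1 (Suc ` {b \<in> A. b < k})) = Suc (card {b \<in> A. b < k})"
    using assms by (intro card_insert_Suc_image) auto
  moreover have "Suc k \<in> insert 1 (Suc ` A) \<longleftrightarrow> k \<in> A" using assms by auto
  ultimately show ?thesis
    unfolding lookup_wedge_var insert_Suc_image_less[OF assms(1)] by simp
qed

text \<open>\<open>G\<^bsub>0\<alpha>\<^esub>\<close> is \<open>G\<^sub>\<alpha>\<close> in the variables \<open>\<theta>\<^sub>2, \<theta>\<^sub>3, \<dots>\<close>, and \<open>G\<^bsub>1\<alpha>\<^esub>\<close> is \<open>\<theta>\<^sub>1\<close> times it plus terms without \<open>\<theta>\<^sub>1\<close>.\<close>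

lemma G_poly_Cons:
  assumes "0 \<notin> A"
  shows "Poly_Mapping.lookup (G_poly (False # \<alpha>)) (Suc ` A) = Poly_Mapping.lookup (G_poly \<alpha>) A \<and>
    Poly_Mapping.lookup (G_poly (False # \<alpha>)) (insert 1 (Suc ` A)) = 0 \<and>
    Poly_Mapping.lookup (G_poly (True # \<alpha>)) (insert 1 (Suc ` A)) = Poly_Mapping.lookup (G_poly \<alpha>) A"
  using assms
proof (induction \<alpha> arbitrary: A rule: G_poly.induct)
  case (1 s t)
  have card: "card (Suc ` A) = card A" by (simp add: card_image)
  have sub1: "insert 1 (Suc ` A) \<subseteq> {1..Suc n} \<longleftrightarrow> A \<subseteq> {1..n}" for n
    using Suc_image_subset_iff[OF 1] by simp
  have card1: "card (insert 1 (Suc ` A)) = Suc (card A)" if "A \<subseteq> {1..n}" for n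
    using card_insert_Suc_image[OF 1] that finite_subset by blast
  have F1: "Poly_Mapping.lookup (F_poly (Suc n) r) (insert 1 (Suc ` A)) =
      (if r = 0 then 0 else Poly_Mapping.lookup (F_poly n (r - 1)) A)" for n r
    unfolding lookup_F_poly sub1 using card1[of n] by auto
  have F0: "Poly_Mapping.lookup (F_poly (Suc n) r) (Suc ` A) = Poly_Mapping.lookup (F_poly n r) A" for n r
    unfolding lookup_F_poly Suc_image_subset_iff[OF 1] card ..
  have G1: "G_poly (True # replicate s True @ replicate t False) = F_poly (Suc (s + t)) (Suc s)"
    using G_poly_base[of "Suc s" t] by simp
  show ?case
  proof (cases s)
    case 0
    have G0: "G_poly (False # replicate s True @ replicate t False) = F_poly (Suc (s + t)) 0"
      using G_poly_base[of 0 "Suc t"] 0 by simp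
    then show ?thesis unfolding G0 G1 G_poly_base F0 F1 using 0 by simp
  next
    case (Suc r)
    have "G_poly (False # replicate s True @ replicate t False)
        = G_poly (replicate s True @ replicate (t + 1) False)
          - wedge (Poly_Mapping.single {Suc 0} 1) (G_poly (replicate r True @ replicate (t + 2) False))"
      using G_poly_step[of s "[]" t] Suc by simp
    \<comment> \<open>Subtracting \<theta>_1 times the next lower \<open>F_poly\<close> removes
      exactly the monomials of \<open>F_poly (Suc (s + t)) s\<close> that contain
      \<theta>_1.\<close>
    then have G0: "G_poly (False # replicate s True @ replicate t False)
        = F_poly (Suc (s + t)) s - wedge (Poly_Mapping.single {Suc 0} 1) (F_poly (Suc (s + t)) r)"
      unfolding G_poly_base using Suc by simp
    have "insert 1 (Suc ` A) - {Suc 0} = Suc ` A" using 1 by auto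
    moreover have none: "{b \<in> insert 1 (Suc ` A). b < Suc 0} = {}" by auto
    ultimately have "Poly_Mapping.lookup (wedge (Poly_Mapping.single {Suc 0} 1) f) (insert 1 (Suc ` A))
        = Poly_Mapping.lookup f (Suc ` A)" for f
      unfolding lookup_wedge_var none by simp
    moreover have "Poly_Mapping.lookup (wedge (Poly_Mapping.single {Suc 0} 1) f) (Suc ` A) = 0" for f
      using 1 by (auto simp: lookup_wedge_var)
    ultimately show ?thesis
      unfolding G0 G1 G_poly_base lookup_minus F0 F1 using Suc F0 by simp
  qed
next
  case (2 s u t)
  let ?k = "length u + 1"
  let ?f = "\<lambda>v. G_poly (v @ replicate s True @ replicate (t + 1) False)"
    and ?g = "\<lambda>v. G_poly (v @ replicate (s - 1) True @ replicate (t + 2) False)"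
  have A: "0 \<notin> A" "0 \<notin> A - {?k}" using 2(4) by auto
  have k: "1 \<le> ?k" by simp
  have G: "G_poly (v @ [False] @ replicate s True @ replicate t False) =
      ?f v - wedge (Poly_Mapping.single {length v + 1} ((- 1) ^ m1 v)) (?g v)" for v
    using 2(1) by (rule G_poly_step)
  have Gx: "G_poly (x # u @ [False] @ replicate s True @ replicate t False) =
      ?f (x # u) - wedge (Poly_Mapping.single {Suc ?k} ((- 1) ^ m1 (x # u))) (?g (x # u))" for x
    using G[of "x # u"] by simp
  \<comment> \<open>A prepended 1 raises \<open>m1\<close> by one, and this sign cancels the one
    from passing \<theta>_1; a prepended 0 changes no sign. So both sides satisfy the same
    recursion.\<close>
  show ?case
    unfolding G[of u] Gx lookup_minus lookup_wedge_var_insert_Suc_image[OF k A(1)]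
      lookup_wedge_var_Suc_image lookup_wedge_var[of ?k]
    using "2.IH"(1)[OF A(1)] "2.IH"(2)[OF A(2)] by simp
qed

lemma lex_less_Suc_image:
  assumes "lex_less A B"
  shows "lex_less (Suc ` A) (Suc ` B)" "0 \<notin> B \<Longrightarrow> lex_less (insert 1 (Suc ` A)) (insert 1 (Suc ` B))"
proof -
  obtain j where j: "\<And>i. i < j \<Longrightarrow> i \<in> A \<longleftrightarrow> i \<in> B" "j \<notin> A" "j \<in> B"
    using assms unfolding lex_less_def by blast
  have *: "i \<in> Suc ` A \<longleftrightarrow> i \<in> Suc ` B" if "i < Suc j" for i
    using that j(1) by (cases i) auto
  then show "lex_less (Suc ` A) (Suc ` B)"
    unfolding lex_less_def using j(2,3) by (intro exI[of _ "Suc j"]) auto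
  assume "0 \<notin> B"
  \<comment> \<open>Otherwise the first difference would land on position 1, where the enlarged sets
    agree.\<close>
  with j(3) have "j \<noteq> 0" by metis
  with * show "lex_less (insert 1 (Suc ` A)) (insert 1 (Suc ` B))"
    unfolding lex_less_def using j(2,3) by (intro exI[of _ "Suc j"]) auto
qed

text \<open>Induction from the left by \<open>G_poly_Cons\<close>: a first letter 0 only shifts the
  indices, and after a first letter 1 the monomials without \<theta>_1 are smaller than all those
  with it.\<close>

lemma G_poly_leading:
  "Poly_Mapping.lookup (G_poly \<alpha>) (ones \<alpha>) = 1 \<and>
    (\<forall>C\<in>Poly_Mapping.keys (G_poly \<alpha>). C \<noteq> ones \<alpha> \<longrightarrow> lex_less C (ones \<alpha>))"
proof (induction \<alpha>)
  case Nil
  show ?case by (auto simp: G_poly_Nil keys_F_poly lookup_F_poly)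
next
  case (Cons x \<alpha>)
  have 0: "0 \<notin> ones \<alpha>" using ones_range[of \<alpha>] by auto
  have "lex_less C (ones (x # \<alpha>))"
    if C: "C \<in> Poly_Mapping.keys (G_poly (x # \<alpha>))" "C \<noteq> ones (x # \<alpha>)" for C
  proof -
    have "0 \<notin> C" using G_poly_range[OF C(1)] by auto
    then obtain A where A: "0 \<notin> A" "C = Suc ` A \<or> C = insert 1 (Suc ` A)"
      by (rule nat_set_Suc_cases)
    have less: "lex_less A (ones \<alpha>)" if "Poly_Mapping.lookup (G_poly \<alpha>) A \<noteq> 0" "A \<noteq> ones \<alpha>"
      using Cons that by (simp add: in_keys_iff)
    show ?thesis
    proof (cases x)
      case True
      show ?thesis
      proof (cases "C = insert 1 (Suc ` A)")
        case in1: True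
        with C True G_poly_Cons[OF A(1), of \<alpha>] have "lex_less A (ones \<alpha>)"
          by (intro less) (auto simp: in_keys_iff ones_Cons)
        from lex_less_Suc_image(2)[OF this 0] show ?thesis using True in1 by (simp add: ones_Cons)
      next
        case False
        with A have "1 \<notin> C" by auto
        moreover have "i \<notin> C" if "i < 1" for i using that \<open>0 \<notin> C\<close> by simp
        ultimately show ?thesis
          unfolding lex_less_def using True by (intro exI[of _ 1]) (auto simp: ones_Cons)
      qed
    next
      case False
      with A C G_poly_Cons[OF A(1), of \<alpha>] have "C = Suc ` A" by (auto simp: in_keys_iff)
      with C False G_poly_Cons[OF A(1), of \<alpha>] have "lex_less A (ones \<alpha>)"
        by (intro less) (auto simp: in_keys_iff ones_Cons)
      from lex_less_Suc_image(1)[OF this] show ?thesis using False \<open>C = Suc ` A\<close>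
        by (simp add: ones_Cons)
    qed
  qed
  moreover have "Poly_Mapping.lookup (G_poly (x # \<alpha>)) (ones (x # \<alpha>)) = 1"
    using Cons G_poly_Cons[OF 0, of \<alpha>] by (cases x) (simp_all add: ones_Cons)
  ultimately show ?case by blast
qed

lemma G_poly_nonzero: "G_poly \<alpha> \<noteq> 0"
  using G_poly_leading[of \<alpha>] by auto

lemma lead_mono_G_poly: "lead_mono (G_poly \<alpha>) = ones \<alpha>"
proof (rule ccontr)
  assume neq: "lead_mono (G_poly \<alpha>) \<noteq> ones \<alpha>"
  have "lex_less (lead_mono (G_poly \<alpha>)) (ones \<alpha>)"
    using G_poly_leading[of \<alpha>] lead_mono_props(1)[OF G_poly_nonzero] neq by blast
  moreover have "ones \<alpha> \<in> Poly_Mapping.keys (G_poly \<alpha>)"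
    using G_poly_leading[of \<alpha>] by (simp add: in_keys_iff)
  then have "lex_less (ones \<alpha>) (lead_mono (G_poly \<alpha>))"
    using neq by (intro lead_mono_props(2)[OF G_poly_nonzero]) auto
  ultimately show False using lex_less_asym by blast
qed

lemma lead_coef_G_poly: "lead_coef (G_poly \<alpha>) = 1"
  using G_poly_leading[of \<alpha>] by (simp add: lead_coef_def lead_mono_G_poly)


section \<open>The Groebner bases\<close>

lemma G_poly_in_I_ideal:
  "breaks_ballot \<alpha> \<Longrightarrow> G_poly \<alpha> \<in> I_ideal (length \<alpha>)"
proof (induction \<alpha> rule: G_poly.induct)
  case (1 s t)
  \<comment> \<open>The zero string, whose \<open>G_poly\<close> is 1, does not break the ballot
    condition; the recursion therefore ends in generators of the ideal.\<close>
  then have "s \<noteq> 0" by (auto simp: breaks_ballot_iff)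
  then show ?case using F_poly_in_I_ideal[of s "s + t"] by (simp only: G_poly_base) simp
next
  case (2 s u t)
  let ?l = "length u"
  let ?\<beta> = "u @ replicate s True @ replicate (t + 1) False"
    and ?\<gamma> = "u @ replicate (s - 1) True @ replicate (t + 2) False"
  obtain r where r: "r \<le> length (u @ [False] @ replicate s True @ replicate t False)"
    "r < 2 * m1 (take r (u @ [False] @ replicate s True @ replicate t False))"
    using 2(4) unfolding breaks_ballot_iff by blast
  have "breaks_ballot ?\<beta> \<and> breaks_ballot ?\<gamma>"
  proof (cases "r \<le> ?l")
    case True
    then show ?thesis using r unfolding breaks_ballot_iff by (intro conjI exI[of _ r]) auto
  next
    case False
    then obtain j where j: "r = ?l + 1 + j" using le_Suc_ex[of "?l + 1" r] by auto
    have "?l + 1 + j < 2 * (m1 u + min j s)"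
      using r(2) unfolding j by simp
    \<comment> \<open>A break after \<open>u\<close> may be moved to the end of the block of ones.
      That block ends at \<open>?l + s\<close> in \<open>?\<beta>\<close> and at
      \<open>?l + (s - 1)\<close> in \<open>?\<gamma>\<close>; the inequality is exactly a break of
      \<open>?\<gamma>\<close> there, and more than enough for \<open>?\<beta>\<close>.\<close>
    then have "?l + 1 < 2 * m1 u + s" by (simp add: min_def split: if_splits)
    then have "?l + s < 2 * m1 (take (?l + s) ?\<beta>)" "?l + (s - 1) < 2 * m1 (take (?l + (s - 1)) ?\<gamma>)"
      using 2(1) by simp_all
    then show ?thesis unfolding breaks_ballot_iff
      by (intro conjI exI[of _ "?l + s"] exI[of _ "?l + (s - 1)"]) simp_all
  qed
  then have "G_poly ?\<beta> \<in> I_ideal (length ?\<beta>)" "G_poly ?\<gamma> \<in> I_ideal (length ?\<gamma>)"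
    using "2.IH" by blast+
  moreover have "length ?\<beta> = ?l + 1 + s + t" "length ?\<gamma> = ?l + 1 + s + t" using 2(1) by simp_all
  ultimately have "G_poly ?\<beta> - wedge (Poly_Mapping.single {?l + 1} ((- 1) ^ m1 u)) (G_poly ?\<gamma>)
      \<in> I_ideal (?l + 1 + s + t)"
    by (intro I_ideal_diff I_ideal_wedge_var) (simp_all only: le_add1 le_add2 add.assoc)
  then show ?case unfolding G_poly_step[OF 2(1)] by (simp add: add.assoc)
qed

lemma breaks_ballot_if_only: "breaks_ballot_only_at_rightmost_one \<alpha> \<Longrightarrow> breaks_ballot \<alpha>"
  unfolding breaks_ballot_only_at_rightmost_one_def breaks_ballot_def rightmost_one_def by blast

text \<open>The predicate \<open>P\<close> ranges over everything between the two families, so that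
  both bases come from one argument: breaking gives membership in the ideal, and the sequences that
  break only at the rightmost 1 already supply all divisors.\<close>

lemma groebner_basis_G_poly:
  assumes "\<And>\<alpha>. breaks_ballot_only_at_rightmost_one \<alpha> \<Longrightarrow> P \<alpha>" "\<And>\<alpha>. P \<alpha> \<Longrightarrow> breaks_ballot \<alpha>"
  shows "groebner_basis (I_ideal n) {G_poly \<alpha> | \<alpha>. length \<alpha> = n \<and> P \<alpha>}"
  unfolding groebner_basis_def
proof (intro conjI ballI impI)
  have "finite {\<alpha> :: bool list. length \<alpha> = n}"
    using finite_lists_length_eq[of "UNIV :: bool set" n] by simp
  then have "finite (G_poly ` {\<alpha>. length \<alpha> = n})" by (rule finite_imageI)
  then show "finite {G_poly \<alpha> | \<alpha>. length \<alpha> = n \<and> P \<alpha>}"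
    by (rule finite_subset[rotated]) auto
  show "{G_poly \<alpha> | \<alpha>. length \<alpha> = n \<and> P \<alpha>} \<subseteq> I_ideal n"
    using G_poly_in_I_ideal assms(2) by blast
  show "0 \<notin> {G_poly \<alpha> | \<alpha>. length \<alpha> = n \<and> P \<alpha>}"
    using G_poly_nonzero by force
  fix f assume f: "f \<in> I_ideal n" "f \<noteq> 0"
  have "lead_mono f \<subseteq> {1..n}" using I_ideal_carrier[OF f(1)] lead_mono_props(1)[OF f(2)] .
  then obtain \<alpha> where \<alpha>: "length \<alpha> = n" "ones \<alpha> = lead_mono f" by (rule ones_surj)
  have "breaks_ballot \<alpha>"
  proof (rule ccontr)
    assume "\<not> breaks_ballot \<alpha>"
    then obtain opn where "noncrossing_matching n (ones \<alpha>) opn"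
      using ballot_noncrossing_matching \<alpha>(1) by blast
    from noncrossing_matching.lead_mono_I_ideal_neq[OF this f] \<alpha>(2) show False by simp
  qed
  then obtain \<beta> where "length \<beta> = length \<alpha>" "breaks_ballot_only_at_rightmost_one \<beta>" "ones \<beta> \<subseteq> ones \<alpha>"
    by (rule first_break)
  then show "\<exists>g\<in>{G_poly \<alpha> | \<alpha>. length \<alpha> = n \<and> P \<alpha>}. lead_mono g \<subseteq> lead_mono f"
    using \<alpha> assms(1) lead_mono_G_poly by blast
qed

theorem corollary4p6:
  fixes n :: nat
  assumes "n \<ge> 1"
  shows "groebner_basis (I_ideal n) {G_poly \<alpha> | \<alpha>. length \<alpha> = n \<and> breaks_ballot \<alpha>}
    \<and> (n \<ge> 2 \<longrightarrow>
        \<not> reduced_groebner_basis (I_ideal n) {G_poly \<alpha> | \<alpha>. length \<alpha> = n \<and> breaks_ballot \<alpha>}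
      \<and> \<not> minimal_groebner_basis (I_ideal n) {G_poly \<alpha> | \<alpha>. length \<alpha> = n \<and> breaks_ballot \<alpha>})
    \<and> minimal_groebner_basis (I_ideal n)
        {G_poly \<alpha> | \<alpha>. length \<alpha> = n \<and> breaks_ballot_only_at_rightmost_one \<alpha>}"
proof (intro conjI impI)
  let ?A = "{G_poly \<alpha> | \<alpha>. length \<alpha> = n \<and> breaks_ballot \<alpha>}"
  show "groebner_basis (I_ideal n) ?A"
    using breaks_ballot_if_only by (rule groebner_basis_G_poly)
  \<comment> \<open>The strings 10...0 and 110...0 both break at position 1, and \<theta>_1 divides
    \<theta>_1 \<theta>_2. For \<open>n = 1\<close> only the string 1 breaks, and such a pair does
    not exist.\<close>
  have divisor: "\<exists>g\<in>?A. \<exists>h\<in>?A. g \<noteq> h \<and> lead_mono g \<subseteq> lead_mono h" if "n \<ge> 2"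
  proof -
    define \<alpha> where "\<alpha> = True # replicate (n - 1) False"
    define \<beta> where "\<beta> = True # True # replicate (n - 2) False"
    have "length \<alpha> = n" "length \<beta> = n" using that by (simp_all add: \<alpha>_def \<beta>_def)
    moreover have "breaks_ballot \<alpha>" "breaks_ballot \<beta>"
      unfolding breaks_ballot_iff by (rule exI[of _ 1], simp add: \<alpha>_def \<beta>_def)+
    moreover have \<alpha>: "ones \<alpha> = {1}" and \<beta>: "ones \<beta> = {1, 2}"
      using ones_append_zeros[of "[]"] by (auto simp: \<alpha>_def \<beta>_def ones_Cons)
    moreover have "lead_mono (G_poly \<alpha>) \<noteq> lead_mono (G_poly \<beta>)"
      unfolding lead_mono_G_poly \<alpha> \<beta> by auto
    then have "G_poly \<alpha> \<noteq> G_poly \<beta>" by auto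
    ultimately show ?thesis
      by (intro bexI[of _ "G_poly \<alpha>"] bexI[of _ "G_poly \<beta>"]) (auto simp: lead_mono_G_poly)
  qed
  show "\<not> minimal_groebner_basis (I_ideal n) ?A" if "n \<ge> 2"
    using divisor[OF that] unfolding minimal_groebner_basis_def by blast
  show "\<not> reduced_groebner_basis (I_ideal n) ?A" if "n \<ge> 2"
  proof
    assume red: "reduced_groebner_basis (I_ideal n) ?A"
    from divisor[OF that] obtain g h
      where gh: "g \<in> ?A" "h \<in> ?A" "g \<noteq> h" "lead_mono g \<subseteq> lead_mono h" by blast
    \<comment> \<open>As \<open>h\<close> is nonzero, its leading monomial occurs in it, so
      divisibility of leading monomials already contradicts reducedness.\<close>
    from red gh(2) have "h \<noteq> 0" unfolding reduced_groebner_basis_def groebner_basis_def by metis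
    from lead_mono_props(1)[OF this] show False
      using red gh unfolding reduced_groebner_basis_def by blast
  qed
  show "minimal_groebner_basis (I_ideal n)
      {G_poly \<alpha> | \<alpha>. length \<alpha> = n \<and> breaks_ballot_only_at_rightmost_one \<alpha>}"
    unfolding minimal_groebner_basis_def
  proof (intro conjI ballI impI)
    show "groebner_basis (I_ideal n)
        {G_poly \<alpha> | \<alpha>. length \<alpha> = n \<and> breaks_ballot_only_at_rightmost_one \<alpha>}"
      using breaks_ballot_if_only by (intro groebner_basis_G_poly)
  next
    fix g h
    assume "g \<in> {G_poly \<alpha> | \<alpha>. length \<alpha> = n \<and> breaks_ballot_only_at_rightmost_one \<alpha>}"
      "h \<in> {G_poly \<alpha> | \<alpha>. length \<alpha> = n \<and> breaks_ballot_only_at_rightmost_one \<alpha>}" "g \<noteq> h"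
    then show "\<not> lead_mono g \<subseteq> lead_mono h"
      using only_at_rightmost_one_antichain by (auto simp: lead_mono_G_poly) metis
  qed (auto simp: lead_coef_G_poly)
qed

end
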